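(* Let $X$ be a Banach space, let $f\in F(X)$ be lower semicontinuous, and let $S\subset X$ be a closed set with $S\cap\operatorname{dom}f\neq\emptyset$. (a) If $S$ is $f$-strongly Tchebychev, then $f+\iota_S$ is essentially firmly subdifferentiable and $S\cap\operatorname{dom}f$ is convex. (b) Conversely, if $X$ is reflexive, $S$ is convex, and $f$ is essentially firmly subdifferentiable, finite and continuous at some point of $S$, then $f+\iota_S$ is strongly adequate; if moreover $f+\iota_S$ is cofinite, then $S$ is $f$-strongly Tchebychev.
   Context: $X$ is a (real) Banach space with topological dual $X^*$ and bidual $X^{**}$; $\langle x,x^*\rangle:=x^*(x)$. $F(X)$ is the class of functions $J:X\to\mathbb{R}\cup\{+\infty\}$ with $\operatorname{dom}J:=\{x\in X: J(x)<\infty\}\neq\emptyset$. $\iota_S$ is the indicator function of $S$ ($0$ on $S$, $+\infty$ off $S$). Conjugate: $J^*(x^* ):=\sup_{x\in X}(\langle x,x^*\rangle-J(x))$ for $x^*\in X^*$. $J$ is cofinite if $J^*$ is finite-valued on $X^*$. Subdifferentials (for $J$ not necessarily convex): $\partial J(x):=\{x^*\in X^*: J(u)\ge J(x)+\langle u-x,x^*\rangle\ \forall u\in X\}$ if $J(x)\in\mathbb{R}$, and $\partial J(x):=\emptyset$ otherwise. Likewise $\partial J^*(x^* ):=\{x^{**}\in X^{**}: J^*(u^* )\ge J^*(x^* )+\langle u^*-x^*,x^{**}\rangle\ \forall u^*\in X^*\}$ if $J^*(x^* )\in\mathbb{R}$, and $\emptyset$ otherwise. The domain of a set-valued map is the set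 of points where its value is nonempty. A function $I\in F(X)$ attains a strong minimum over a set $S$ if it has a minimum point $\bar x\in S$ over $S$ and every sequence $(x_n)$ in $S$ with $I(x_n)\to\inf_S I$ converges in norm to $\bar x$. $S$ is $f$-strongly Tchebychev if for every $x^*\in X^*$ the function $f-x^*$, i.e. $x\mapsto f(x)-\langle x,x^*\rangle$, attains a strong minimum over $S$. $J\in F(X)$ is strongly adequate if $\operatorname{dom}\partial J^*$ is a nonempty open subset of $X^*$ and $J-x^*$ attains a strong minimum over $X$ for every $x^*\in\operatorname{dom}\partial J^*$. $\Gamma_0$ is the set of lower semicontinuous convex functions $\psi:\mathbb{R}_+\to[0,\infty]$ such that $\psi(t)=0\iff t=0$. A convex function $H\in F(X)$ is firmly subdifferentiable at $x\in\operatorname{dom}\partial H$ if for every $x^*\in\partial H(x)$ there exists $\psi\in\Gamma_0$ such that $H(u)\ge H(x)+\langle u-x,x^*\rangle+\psi(\|u-x\|)$ for all $u\in X$. A function $H\in F(X)$ is essentially firmly subdifferentiable if it is convex and is firmly subdifferentiable at each point of $\operatorname{dom}\partial H$. *)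

theory Defs
  imports "HOL-Analysis.Analysis"
begin

text \<open>
  Functions with values in \<open>\<real> \<union> {+\<infinity>}\<close> are modelled as \<^typ>\<open>ereal\<close>-valued functions that avoid
  \<open>-\<infinity>\<close>. The topological dual of \<^typ>\<open>'a::real_normed_vector\<close> is \<^typ>\<open>'a::real_normed_vector \<Rightarrow>\<^sub>L real\<close>,
  with the operator norm; the pairing of \<open>x\<close> and \<open>\<phi>\<close> is \<open>blinfun_apply \<phi> x\<close>.
\<close>

definition eff_domain :: "('a \<Rightarrow> ereal) \<Rightarrow> 'a set"
  where "eff_domain J = {x. J x < \<infinity>}"

definition proper_funs :: "('a \<Rightarrow> ereal) set"
  where "proper_funs = {J. (\<forall>x. J x \<noteq> -\<infinity>) \<and> eff_domain J \<noteq> {}}"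

definition indicator_inf :: "'a set \<Rightarrow> 'a \<Rightarrow> ereal"
  where "indicator_inf S x = (if x \<in> S then 0 else \<infinity>)"

definition lsc_on :: "'a::topological_space set \<Rightarrow> ('a \<Rightarrow> ereal) \<Rightarrow> bool"
  where "lsc_on S f \<longleftrightarrow> (\<forall>x\<in>S. f x \<le> Liminf (at x within S) f)"

text \<open>
  The weights are restricted to the open unit interval, so that products \<open>0 * \<infinity>\<close> do not occur.
  The definition is only meaningful for functions that do not take the value \<open>-\<infinity>\<close> on \<open>S\<close>.
\<close>
definition ereal_convex_on :: "'a::real_vector set \<Rightarrow> ('a \<Rightarrow> ereal) \<Rightarrow> bool"
  where "ereal_convex_on S f \<longleftrightarrow> convex S \<and>
    (\<forall>x\<in>S. \<forall>y\<in>S. \<forall>t. 0 < t \<and> t < 1 \<longrightarrow>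
      f ((1 - t) *\<^sub>R x + t *\<^sub>R y) \<le> ereal (1 - t) * f x + ereal t * f y)"

definition conjugate :: "('a::real_normed_vector \<Rightarrow> ereal) \<Rightarrow> ('a \<Rightarrow>\<^sub>L real) \<Rightarrow> ereal"
  where "conjugate J \<phi> = (SUP x. ereal (blinfun_apply \<phi> x) - J x)"

definition cofinite_fun :: "('a::real_normed_vector \<Rightarrow> ereal) \<Rightarrow> bool"
  where "cofinite_fun J \<longleftrightarrow> (\<forall>\<phi>. \<bar>conjugate J \<phi>\<bar> \<noteq> \<infinity>)"

text \<open>
  For \<open>J\<close> on \<open>X\<close> the subgradients lie in \<open>X\<^sup>*\<close>; applied to \<open>conjugate J\<close>, a function on \<open>X\<^sup>*\<close>,
  the same definition gives subgradients in the bidual.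
\<close>
definition subdifferential ::
    "('a::real_normed_vector \<Rightarrow> ereal) \<Rightarrow> 'a \<Rightarrow> ('a \<Rightarrow>\<^sub>L real) set"
  where "subdifferential J x =
    (if \<bar>J x\<bar> \<noteq> \<infinity>
     then {\<phi>. \<forall>u. J u \<ge> J x + ereal (blinfun_apply \<phi> (u - x))}
     else {})"

definition dom_subdifferential :: "('a::real_normed_vector \<Rightarrow> ereal) \<Rightarrow> 'a set"
  where "dom_subdifferential J = {x. subdifferential J x \<noteq> {}}"

definition attains_strong_minimum :: "('a::metric_space \<Rightarrow> ereal) \<Rightarrow> 'a set \<Rightarrow> bool"
  where "attains_strong_minimum I S \<longleftrightarrow> I \<in> proper_funs \<and>
    (\<exists>m\<in>S. (\<forall>x\<in>S. I m \<le> I x) \<and>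
      (\<forall>y. (\<forall>n. y n \<in> S) \<and> (\<lambda>n. I (y n)) \<longlonglongrightarrow> (INF x\<in>S. I x) \<longrightarrow> y \<longlonglongrightarrow> m))"

definition strongly_Tchebychev :: "('a::real_normed_vector \<Rightarrow> ereal) \<Rightarrow> 'a set \<Rightarrow> bool"
  where "strongly_Tchebychev f S \<longleftrightarrow>
    (\<forall>\<phi>. attains_strong_minimum (\<lambda>x. f x - ereal (blinfun_apply \<phi> x)) S)"

definition strongly_adequate :: "('a::real_normed_vector \<Rightarrow> ereal) \<Rightarrow> bool"
  where "strongly_adequate J \<longleftrightarrow> J \<in> proper_funs \<and>
    dom_subdifferential (conjugate J) \<noteq> {} \<and>
    open (dom_subdifferential (conjugate J)) \<and>
    (\<forall>\<phi>\<in>dom_subdifferential (conjugate J).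
      attains_strong_minimum (\<lambda>x. J x - ereal (blinfun_apply \<phi> x)) UNIV)"

text \<open>
  The class of functions \<open>\<psi> : [0, \<infinity>) \<rightarrow> [0, \<infinity>]\<close>; the values of \<open>\<psi>\<close> at negative reals are irrelevant.
\<close>
definition Gamma0 :: "(real \<Rightarrow> ereal) set"
  where "Gamma0 = {\<psi>. lsc_on {0..} \<psi> \<and> ereal_convex_on {0..} \<psi> \<and>
    (\<forall>t\<ge>0. 0 \<le> \<psi> t \<and> (\<psi> t = 0 \<longleftrightarrow> t = 0))}"

definition firmly_subdifferentiable_at :: "('a::real_normed_vector \<Rightarrow> ereal) \<Rightarrow> 'a \<Rightarrow> bool"
  where "firmly_subdifferentiable_at H x \<longleftrightarrow> x \<in> dom_subdifferential H \<and>
    (\<forall>\<phi>\<in>subdifferential H x. \<exists>\<psi>\<in>Gamma0. \<forall>u.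
      H u \<ge> H x + ereal (blinfun_apply \<phi> (u - x)) + \<psi> (norm (u - x)))"

definition essentially_firmly_subdifferentiable ::
    "('a::real_normed_vector \<Rightarrow> ereal) \<Rightarrow> bool"
  where "essentially_firmly_subdifferentiable H \<longleftrightarrow> H \<in> proper_funs \<and>
    ereal_convex_on UNIV H \<and>
    (\<forall>x\<in>dom_subdifferential H. firmly_subdifferentiable_at H x)"

lift_definition bidual_embedding ::
    "'a::real_normed_vector \<Rightarrow> (('a \<Rightarrow>\<^sub>L real) \<Rightarrow>\<^sub>L real)"
  is "\<lambda>x \<phi>. blinfun_apply \<phi> x"
  by (rule blinfun.bounded_linear_left)

definition reflexive_space :: "'a::real_normed_vector itself \<Rightarrow> bool"
  where "reflexive_space _ \<longleftrightarrow>
    surj (bidual_embedding :: 'a \<Rightarrow> (('a \<Rightarrow>\<^sub>L real) \<Rightarrow>\<^sub>L real))"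

end

theory Submission
  imports Defs
begin

text \<open>
  Write \<open>J\<close> for \<open>f + \<iota>\<^sub>S\<close>, a proper lower semicontinuous function. Both directions compare
  subgradients of \<open>J\<close> with minimum points of its linear perturbations \<open>J - \<phi>\<close>.

  If every \<open>J - \<phi>\<close> has a strong minimum point \<open>p \<phi>\<close>, then the conjugate of \<open>J\<close> is finite
  everywhere, hence locally bounded by Baire's theorem, and this boundedness turns the values of \<open>p\<close>
  along a line through \<open>\<phi>\<close> into minimizing sequences: \<open>p\<close> is continuous along lines
  (\<open>strong_minimizers_radially_continuous\<close>). At the points \<open>p \<phi>\<close> the function \<open>J\<close>
  agrees with its biconjugate. To reach an arbitrary point \<open>x\<close>, Ekeland's principle is applied in the dual space to
  the function that sends \<open>\<phi>\<close> to \<open>J\<^sup>*(\<phi>) - \<phi>(x)\<close>; an almost stationary point \<open>\<phi>\<close> of it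
  yields \<open>p \<phi>\<close> close to \<open>x\<close> with \<open>J(p \<phi>)\<close> not much larger than the biconjugate at \<open>x\<close>. Lower
  semicontinuity then shows that \<open>J\<close> equals its biconjugate, so it is convex
  (\<open>biconjugate_of_strong_minimizers\<close>). Once \<open>J\<close> is convex, the excess
  \<open>J(u) - J(x) - \<phi>(u - x)\<close> at a strong minimum is bounded away from zero on every sphere around
  \<open>x\<close> and so grows linearly outside it, which is what firmness amounts to
  (\<open>firm_of_strong_minimum\<close>).

  For the converse, let \<open>\<phi>\<close> be in the domain of the subdifferential of \<open>J\<^sup>*\<close>. By reflexivity a subgradient
  of \<open>J\<^sup>*\<close> at \<open>\<phi>\<close> is evaluation at a point \<open>x\<close>, and the equality of \<open>J\<close> with its biconjugate makes
  \<open>\<phi>\<close> a subgradient of \<open>J\<close> at \<open>x\<close> (\<open>bidual_subgradient_is_subgradient\<close>). Continuity of \<open>f\<close> at a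
  point of \<open>S\<close> splits \<open>\<phi>\<close> into a subgradient of \<open>f\<close>, which is firm, and a normal
  functional of \<open>S\<close>, which does not spoil firmness (\<open>subgradient_sum_rule_constraint\<close>). Firm growth
  gives the strong minimum. It also absorbs small changes of \<open>\<phi>\<close>, so that \<open>J\<^sup>*\<close> is bounded, and
  therefore has subgradients, near \<open>\<phi>\<close>; this is the openness. When \<open>J\<^sup>*\<close> is finite everywhere,
  Baire's theorem provides the boundedness near every functional.

  All separation arguments go through one consequence of the Hahn--Banach theorem, a supporting
  hyperplane of a convex subset of \<open>X \<times> \<real>\<close> (\<open>subgradient_of_convex_set\<close>). Infima such as
  inf-convolutions enter only as convex sets of the pairs that lie above them, which keeps the arguments
  in real numbers.
\<close>

section \<open>The Hahn--Banach theorem and subgradients of convex sets\<close>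

definition sublinear :: "('a::real_vector \<Rightarrow> real) \<Rightarrow> bool"
  where "sublinear p \<longleftrightarrow> (\<forall>x y. p (x + y) \<le> p x + p y) \<and> (\<forall>c>0. \<forall>x. p (c *\<^sub>R x) = c * p x)"

lemma sublinear_zero: "sublinear p \<Longrightarrow> p 0 = 0"
proof -
  assume "sublinear p"
  then have "p (2 *\<^sub>R 0) = 2 * p 0"
    unfolding sublinear_def by (metis zero_less_numeral)
  then show ?thesis by simp
qed

lemma sublinear_neg: "sublinear p \<Longrightarrow> - p (- x) \<le> p x"
proof -
  assume p: "sublinear p"
  then have "p (x + - x) \<le> p x + p (- x)"
    unfolding sublinear_def by blast
  with sublinear_zero[OF p] show ?thesis by simp
qed

text \<open>
  Zorn's lemma on sublinear functionals ordered pointwise: along a chain the pointwise infimum is again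
  sublinear, since two members can be replaced by the smaller one, and it is finite because every
  member \<open>p\<close> satisfies \<open>p(x) \<ge> -p(-x) \<ge> -q(-x)\<close>. Minimality replaces the usual extension of
  partially defined functionals.
\<close>
lemma minimal_sublinear_below:
  assumes "sublinear q"
  obtains p where "sublinear p" "\<And>x. p x \<le> q x"
    "\<And>p'. \<lbrakk>sublinear p'; \<And>x. p' x \<le> p x\<rbrakk> \<Longrightarrow> p' = p"
proof -
  define A where "A = {p. sublinear p \<and> (\<forall>x. p x \<le> q x)}"
  define P where "P = (\<lambda>a b. \<forall>x. (b::'a \<Rightarrow> real) x \<le> a x)"
  have "\<exists>m\<in>A. \<forall>a\<in>A. P m a \<longrightarrow> a = m"
  proof (rule predicate_Zorn)
    show "partial_order_on A (relation_of P A)"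
      by (rule partial_order_on_relation_ofI) (auto simp: P_def fun_eq_iff intro: order_trans antisym)
  next
    fix C assume "C \<in> Chains (relation_of P A)"
    then have CA: "C \<subseteq> A" and total: "\<And>a b. a \<in> C \<Longrightarrow> b \<in> C \<Longrightarrow> P a b \<or> P b a"
      unfolding Chains_def relation_of_def by auto
    show "\<exists>u\<in>A. \<forall>a\<in>C. P a u"
    proof (cases "C = {}")
      case True
      have "q \<in> A" using assms by (simp add: A_def)
      with True show ?thesis by auto
    next
      case False
      define u where "u = (\<lambda>x. INF p\<in>C. p x)"
      have below: "- q (- x) \<le> p x" if "p \<in> C" for p x
        using sublinear_neg[of p x] that CA unfolding A_def
        by (smt (verit) mem_Collect_eq subset_iff)
      have bdd: "bdd_below ((\<lambda>p. p x) ` C)" for x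
        using below by (intro bdd_belowI[of _ "- q (- x)"]) auto
      have u_le: "u x \<le> p x" if "p \<in> C" for p x
        unfolding u_def using bdd that by (rule cINF_lower)
      have le_u: "c \<le> u x" if "\<And>p. p \<in> C \<Longrightarrow> c \<le> p x" for c x
        unfolding u_def using False that by (intro cINF_greatest) auto
      have add: "u (x + y) \<le> u x + u y" for x y
      proof -
        have "u (x + y) \<le> p x + p' y" if pp: "p \<in> C" "p' \<in> C" for p p'
        proof -
          obtain r where r: "r \<in> C" "r x \<le> p x" "r y \<le> p' y"
            using total[OF pp] pp unfolding P_def by blast
          have "u (x + y) \<le> r (x + y)" using u_le r by blast
          also have "\<dots> \<le> r x + r y" using r CA unfolding A_def sublinear_def by auto
          finally show ?thesis using r by linarith
        qed
        then have "u (x + y) - p' y \<le> u x" if "p' \<in> C" for p'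
          using that by (intro le_u) (smt (verit))
        then have "u (x + y) - u x \<le> u y"
          by (intro le_u) (smt (verit))
        then show ?thesis by linarith
      qed
      have scale_le: "c * u x \<le> u (c *\<^sub>R x)" if "c > 0" for c x
      proof (rule le_u)
        fix p assume "p \<in> C"
        then have "p (c *\<^sub>R x) = c * p x" using CA that unfolding A_def sublinear_def by auto
        with u_le[OF \<open>p \<in> C\<close>, of x] that show "c * u x \<le> p (c *\<^sub>R x)" by simp
      qed
      have scale: "u (c *\<^sub>R x) = c * u x" if "c > 0" for c x
      proof (rule antisym)
        have "inverse c * u (c *\<^sub>R x) \<le> u (inverse c *\<^sub>R (c *\<^sub>R x))"
          using that by (intro scale_le) simp
        with that show "u (c *\<^sub>R x) \<le> c * u x" by (simp add: field_simps)
      qed (rule scale_le[OF that])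
      obtain p where "p \<in> C" using False by auto
      then have "u x \<le> q x" for x
        using u_le[of p x] CA unfolding A_def by (smt (verit) mem_Collect_eq subset_iff)
      then have "u \<in> A" using add scale by (simp add: A_def sublinear_def)
      then show ?thesis using u_le unfolding P_def by blast
    qed
  qed
  then obtain p where p: "p \<in> A" "\<And>a. a \<in> A \<Longrightarrow> P p a \<Longrightarrow> a = p" by blast
  show ?thesis
  proof (rule that)
    show "sublinear p" "\<And>x. p x \<le> q x" using p by (auto simp: A_def)
    fix p' assume "sublinear p'" "\<And>x. p' x \<le> p x"
    with p show "p' = p"
      by (intro p(2)) (auto simp: A_def P_def intro: order_trans)
  qed
qed

text \<open>
  The modification that decides linearity: \<open>r\<close> is the largest sublinear functional below \<open>p\<close> that is at most
  \<open>-p(y)\<close> at \<open>-y\<close>. It coincides with \<open>p\<close> if \<open>p\<close> is minimal.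
\<close>
lemma sublinear_translate:
  fixes y :: "'a::real_vector"
  assumes p: "sublinear p"
  defines "r \<equiv> \<lambda>x. INF t\<in>{0..}. p (x + t *\<^sub>R y) - t * p y"
  shows "sublinear r" and "t \<ge> 0 \<Longrightarrow> r x \<le> p (x + t *\<^sub>R y) - t * p y"
proof -
  have padd: "p (x + z) \<le> p x + p z" and pscale: "c > 0 \<Longrightarrow> p (c *\<^sub>R x) = c * p x" for x z c
    using p unfolding sublinear_def by auto
  have pscale0: "p (c *\<^sub>R x) = c * p x" if "c \<ge> 0" for c x
    using pscale[of c x] sublinear_zero[OF p] that by (cases "c = 0") auto
  have below: "- p (- x) \<le> p (x + t *\<^sub>R y) - t * p y" if "t \<ge> 0" for t x
    using padd[of "x + t *\<^sub>R y" "- x"] pscale0[of t y] that by simp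
  have bdd: "bdd_below ((\<lambda>t. p (x + t *\<^sub>R y) - t * p y) ` {0..})" for x
    using below by (intro bdd_belowI[of _ "- p (- x)"]) auto
  have r_le: "r x \<le> p (x + t *\<^sub>R y) - t * p y" if "t \<ge> 0" for t x
    unfolding r_def using that by (intro cINF_lower[OF bdd]) auto
  then show "t \<ge> 0 \<Longrightarrow> r x \<le> p (x + t *\<^sub>R y) - t * p y" .
  have le_r: "c \<le> r x" if "\<And>t. t \<ge> 0 \<Longrightarrow> c \<le> p (x + t *\<^sub>R y) - t * p y" for c x
    unfolding r_def using that by (intro cINF_greatest) auto
  have add: "r (x + z) \<le> r x + r z" for x z
  proof -
    have *: "r (x + z) \<le> (p (x + s *\<^sub>R y) - s * p y) + (p (z + t *\<^sub>R y) - t * p y)"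
      if "s \<ge> 0" "t \<ge> 0" for s t
      using r_le[of "s + t" "x + z"] padd[of "x + s *\<^sub>R y" "z + t *\<^sub>R y"] that
      by (simp add: algebra_simps)
    have "r (x + z) - (p (x + s *\<^sub>R y) - s * p y) \<le> r z" if "s \<ge> 0" for s
    proof (rule le_r)
      fix t :: real assume "t \<ge> 0"
      from *[OF that this]
      show "r (x + z) - (p (x + s *\<^sub>R y) - s * p y) \<le> p (z + t *\<^sub>R y) - t * p y" by linarith
    qed
    then have "r (x + z) - r z \<le> p (x + s *\<^sub>R y) - s * p y" if "s \<ge> 0" for s
      using that by (smt (verit))
    then have "r (x + z) - r z \<le> r x" by (rule le_r)
    then show ?thesis by linarith
  qed
  have scale_le: "c * r x \<le> r (c *\<^sub>R x)" if "c > 0" for c x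
  proof (rule le_r)
    fix t :: real assume "t \<ge> 0"
    with that have "c * r x \<le> c * (p (x + (t / c) *\<^sub>R y) - (t / c) * p y)"
      by (intro mult_left_mono r_le) auto
    also have "\<dots> = p (c *\<^sub>R (x + (t / c) *\<^sub>R y)) - t * p y"
      unfolding pscale[OF that] using that by (simp add: algebra_simps)
    finally show "c * r x \<le> p (c *\<^sub>R x + t *\<^sub>R y) - t * p y"
      using that by (simp add: scaleR_add_right)
  qed
  have scale: "r (c *\<^sub>R x) = c * r x" if "c > 0" for c x
  proof (rule antisym)
    have "inverse c * r (c *\<^sub>R x) \<le> r (inverse c *\<^sub>R (c *\<^sub>R x))"
      using that by (intro scale_le) simp
    with that show "r (c *\<^sub>R x) \<le> c * r x" by (simp add: field_simps)
  qed (rule scale_le[OF that])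
  show "sublinear r"
    using add scale by (simp add: sublinear_def)
qed

text \<open>
  A minimal sublinear functional \<open>p\<close> is not lowered by the translation construction, and the parameter
  value \<open>t = 1\<close> there reads \<open>p(x) + p(y) \<le> p(x + y)\<close>. So \<open>p\<close> is additive, hence linear.
\<close>
theorem Hahn_Banach_sublinear:
  fixes q :: "'a::real_vector \<Rightarrow> real"
  assumes "sublinear q"
  obtains l where "linear l" "\<And>x. l x \<le> q x"
proof -
  obtain p where p: "sublinear p" "\<And>x. p x \<le> q x"
    and min: "\<And>p'. \<lbrakk>sublinear p'; \<And>x. p' x \<le> p x\<rbrakk> \<Longrightarrow> p' = p"
    using minimal_sublinear_below[OF assms] by metis
  have superadd: "p x + p y \<le> p (x + y)" for x y
  proof -
    define r where "r = (\<lambda>x. INF t\<in>{0..}. p (x + t *\<^sub>R y) - t * p y)"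
    have r_le: "r x \<le> p (x + t *\<^sub>R y) - t * p y" if "t \<ge> 0" for t x
      unfolding r_def using p(1) that by (rule sublinear_translate(2))
    have "sublinear r"
      unfolding r_def using p(1) by (rule sublinear_translate(1))
    then have "r = p"
      using r_le[of 0] by (intro min) auto
    with r_le[of 1 x] show ?thesis by simp
  qed
  then have add: "p (x + y) = p x + p y" for x y
    using p(1) unfolding sublinear_def by (meson antisym)
  have scale_pos: "p (c *\<^sub>R x) = c * p x" if "c > 0" for c x
    using p(1) that unfolding sublinear_def by blast
  have p0: "p 0 = 0" using p(1) by (rule sublinear_zero)
  have neg: "p (- x) = - p x" for x
    using add[of x "- x"] p0 by simp
  have "p (c *\<^sub>R x) = c * p x" for c x
  proof (cases c "0::real" rule: linorder_cases)
    case less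
    then show ?thesis using scale_pos[of "- c" x] neg[of "c *\<^sub>R x"] by simp
  qed (auto simp: scale_pos p0)
  then have "linear p"
    using add by (intro linearI) auto
  with p(2) show ?thesis by (rule that[rotated])
qed

text \<open>
  A supporting hyperplane of \<open>C\<close> below height \<open>r\<close> over \<open>x\<close>. The infimum \<open>q(h)\<close> of the slopes of
  \<open>C\<close>, seen from \<open>(x, r)\<close> in the direction \<open>h\<close>, is sublinear by convexity. The flat disc of height \<open>M\<close> over
  the ball makes every \<open>q(h)\<close> finite and bounds each linear functional below \<open>q\<close>.
\<close>
theorem subgradient_of_convex_set:
  fixes C :: "('a::real_normed_vector \<times> real) set"
  assumes C: "convex C"
    and above: "\<And>s. (x, s) \<in> C \<Longrightarrow> r \<le> s"
    and \<rho>: "\<rho> > 0" "\<And>u. dist u x < \<rho> \<Longrightarrow> (u, M) \<in> C"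
  obtains b :: "'a \<Rightarrow>\<^sub>L real" where "\<And>u s. (u, s) \<in> C \<Longrightarrow> r + b (u - x) \<le> s"
proof -
  define V where "V = (\<lambda>h. {(s - r) / t | s t. t > 0 \<and> (x + t *\<^sub>R h, s) \<in> C})"
  define q where "q = (\<lambda>h. Inf (V h))"
  have comb: "(a *\<^sub>R u + b *\<^sub>R v, a * s + b * s') \<in> C"
    if "(u, s) \<in> C" "(v, s') \<in> C" "a \<ge> 0" "b \<ge> 0" "a + b = 1" for u v s s' a b
    using convexD[OF C that] by simp
  have nbhd: "(x + t *\<^sub>R h, M) \<in> C" if "t * norm h < \<rho>" "t \<ge> 0" for t h
    using that by (intro \<rho>(2)) (simp add: dist_norm)
  have small: "\<exists>t>0. t * norm h < \<rho>" for h :: 'a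
    using \<rho>(1) by (intro exI[of _ "\<rho> / (1 + norm h)"]) (auto simp: field_simps add_pos_nonneg)
  have Vne: "V h \<noteq> {}" for h
  proof -
    obtain t where "t > 0" "t * norm h < \<rho>" using small by blast
    then have "(M - r) / t \<in> V h" using nbhd[of t h] by (auto simp: V_def)
    then show ?thesis by blast
  qed
  \<comment> \<open>A slope in direction \<open>h\<close> and one in direction \<open>h'\<close> add up to a slope in direction \<open>h + h'\<close>:
    the weights are chosen so that both points contribute the same step \<open>\<tau>\<close>.\<close>
  have add: "\<exists>w\<in>V (h + h'). w \<le> v + v'" if v: "v \<in> V h" and v': "v' \<in> V h'" for h h' v v'
  proof -
    obtain s t where st: "v = (s - r) / t" "t > 0" "(x + t *\<^sub>R h, s) \<in> C"
      using v unfolding V_def by auto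
    obtain s' t' where st': "v' = (s' - r) / t'" "t' > 0" "(x + t' *\<^sub>R h', s') \<in> C"
      using v' unfolding V_def by auto
    define a where "a = t' / (t + t')"
    define b where "b = t / (t + t')"
    define \<tau> where "\<tau> = t * t' / (t + t')"
    have ab: "a + b = 1" "a \<ge> 0" "b \<ge> 0" "a * t = \<tau>" "b * t' = \<tau>" "\<tau> > 0"
      using st(2) st'(2) by (simp_all add: a_def b_def \<tau>_def add_divide_distrib[symmetric] add.commute)
    have "(a *\<^sub>R (x + t *\<^sub>R h) + b *\<^sub>R (x + t' *\<^sub>R h'), a * s + b * s') \<in> C"
      using ab by (intro comb st st') auto
    also have "a *\<^sub>R (x + t *\<^sub>R h) + b *\<^sub>R (x + t' *\<^sub>R h') =
        (a + b) *\<^sub>R x + ((a * t) *\<^sub>R h + (b * t') *\<^sub>R h')"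
      by (simp add: algebra_simps)
    also have "\<dots> = x + \<tau> *\<^sub>R (h + h')"
      by (simp add: ab scaleR_add_right)
    finally have "(a * s + b * s' - r) / \<tau> \<in> V (h + h')"
      using ab by (auto simp: V_def)
    moreover have "(a * s + b * s' - r) / \<tau> = v + v'"
    proof -
      have "a * s + b * s' - r = a * (s - r) + b * (s' - r)"
        using ab(1) by (simp add: algebra_simps) (metis distrib_left mult.commute mult.right_neutral)
      also have "\<dots> / \<tau> = a * (s - r) / (a * t) + b * (s' - r) / (b * t')"
        by (simp add: ab add_divide_distrib)
      also have "\<dots> = v + v'"
        using ab st st' by (auto simp: a_def b_def)
      finally show ?thesis .
    qed
    ultimately show ?thesis by auto
  qed
  have V0: "0 \<le> w" if "w \<in> V 0" for w
    using that above by (auto simp: V_def)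
  \<comment> \<open>Slopes in opposite directions have a nonnegative sum, as they add up to a slope in direction \<open>0\<close>.\<close>
  have bdd: "bdd_below (V h)" for h
  proof -
    obtain v where v: "v \<in> V (- h)" using Vne by blast
    have "- v \<le> w" if w: "w \<in> V h" for w
      using add[OF w v] V0 by fastforce
    then show ?thesis by (intro bdd_belowI)
  qed
  have q_le: "q h \<le> v" if "v \<in> V h" for h v
    unfolding q_def using that bdd by (rule cInf_lower)
  have le_q: "c \<le> q h" if "\<And>v. v \<in> V h \<Longrightarrow> c \<le> v" for c h
    unfolding q_def using Vne that by (rule cInf_greatest)
  have qadd: "q (h + h') \<le> q h + q h'" for h h'
  proof -
    have *: "q (h + h') \<le> v + v'" if "v \<in> V h" "v' \<in> V h'" for v v'
      using add[OF that] q_le by fastforce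
    have "q (h + h') - v \<le> q h'" if "v \<in> V h" for v
      using *[OF that] by (intro le_q) (simp add: algebra_simps)
    then have "q (h + h') - q h' \<le> q h"
      by (intro le_q) (smt (verit))
    then show ?thesis by linarith
  qed
  have scale_le: "c * q h \<le> q (c *\<^sub>R h)" if "c > 0" for c h
  proof (rule le_q)
    fix v assume "v \<in> V (c *\<^sub>R h)"
    then obtain s t where st: "v = (s - r) / t" "t > 0" "(x + t *\<^sub>R (c *\<^sub>R h), s) \<in> C"
      unfolding V_def by auto
    then have "(s - r) / (t * c) \<in> V h"
      using that unfolding V_def
      by (intro CollectI exI[of _ s] exI[of _ "t * c"]) (simp add: mult.commute)
    then have "c * q h \<le> c * ((s - r) / (t * c))"
      using that by (intro mult_left_mono q_le) auto
    with that st show "c * q h \<le> v" by simp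
  qed
  have qscale: "q (c *\<^sub>R h) = c * q h" if "c > 0" for c h
  proof (rule antisym)
    have "inverse c * q (c *\<^sub>R h) \<le> q (inverse c *\<^sub>R (c *\<^sub>R h))"
      using that by (intro scale_le) simp
    with that show "q (c *\<^sub>R h) \<le> c * q h" by (simp add: field_simps)
  qed (rule scale_le[OF that])
  obtain l where l: "linear l" "\<And>h. l h \<le> q h"
    using qadd qscale Hahn_Banach_sublinear[of q] unfolding sublinear_def by metis
  interpret l: linear l by (rule l(1))
  have Mr: "r \<le> M" using above \<rho> by auto
  \<comment> \<open>The slope reached by walking half the radius \<open>\<rho>\<close> to the disc of height \<open>M\<close>.\<close>
  define K where "K = (M - r) * 2 / \<rho>"
  have l_le: "l h \<le> K * norm h" for h
  proof (cases "h = 0")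
    case False
    define t where "t = \<rho> / (2 * norm h)"
    have t: "t > 0" "t * norm h < \<rho>" using False \<rho>(1) by (auto simp: t_def)
    then have "(M - r) / t \<in> V h" using nbhd[of t h] by (auto simp: V_def)
    then have "l h \<le> (M - r) / t" using l(2)[of h] q_le by (meson order_trans)
    also have "\<dots> = K * norm h" using False \<rho>(1) by (simp add: t_def K_def field_simps)
    finally show ?thesis .
  qed (simp add: l.zero)
  have "\<bar>l h\<bar> \<le> norm h * K" for h
    using l_le[of h] l_le[of "- h"] by (simp add: l.neg abs_le_iff mult.commute)
  then have "bounded_linear l"
    by (intro bounded_linear_intro[of l K] l.add l.scale) (simp_all add: l.scale)
  then have bl: "blinfun_apply (Blinfun l) = l" by (rule bounded_linear_Blinfun_apply)
  show ?thesis
  proof (rule that)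
    fix u s assume "(u, s) \<in> C"
    then have "(s - r) / 1 \<in> V (u - x)"
      unfolding V_def by (intro CollectI exI[of _ s] exI[of _ "1::real"]) auto
    then show "r + Blinfun l (u - x) \<le> s"
      using q_le[of "s - r" "u - x"] l(2)[of "u - x"] by (simp add: bl)
  qed
qed

text \<open>
  A subgradient of the norm at \<open>x\<close>: comparing its values at \<open>0\<close>, \<open>x\<close> and \<open>2x\<close> forces
  \<open>b(x) = \<parallel>x\<parallel>\<close>, and then the subgradient inequality is the bound on \<open>b\<close>.
\<close>
lemma norming_functional:
  fixes x :: "'a::real_normed_vector"
  obtains b :: "'a \<Rightarrow>\<^sub>L real" where "norm b \<le> 1" "b x = norm x"
proof -
  define C where "C = {(u::'a, s::real). norm u \<le> s}"
  have "convex C"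
    unfolding C_def convex_def
  proof clarsimp
    fix u v :: 'a and s t a b :: real
    assume "norm u \<le> s" "norm v \<le> t" "0 \<le> a" "0 \<le> b"
    then have "norm (a *\<^sub>R u) \<le> a * s" "norm (b *\<^sub>R v) \<le> b * t"
      by (auto intro: mult_left_mono)
    then show "norm (a *\<^sub>R u + b *\<^sub>R v) \<le> a * s + b * t"
      by (intro norm_triangle_mono)
  qed
  moreover have "norm x \<le> s" if "(x, s) \<in> C" for s
    using that by (simp add: C_def)
  moreover have "(u, norm x + 1) \<in> C" if "dist u x < 1" for u
    using that norm_triangle_ineq2[of u x] by (auto simp: C_def dist_norm)
  ultimately obtain b :: "'a \<Rightarrow>\<^sub>L real" where b0: "\<And>u s. (u, s) \<in> C \<Longrightarrow> norm x + b (u - x) \<le> s"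
    using subgradient_of_convex_set[of C x "norm x" 1] by (metis zero_less_one)
  have b: "norm x + b u - b x \<le> norm u" for u
    using b0[of u "norm u"] by (simp add: C_def blinfun.diff_right)
  have bx: "b x = norm x"
    using b[of 0] b[of "2 *\<^sub>R x"] by (simp add: blinfun.zero_right blinfun.scaleR_right)
  have "norm (b u) \<le> 1 * norm u" for u
    using b[of u] b[of "- u"] bx by (simp add: blinfun.minus_right abs_le_iff)
  then have "norm b \<le> 1"
    by (intro norm_blinfun_bound) auto
  with bx show ?thesis by (rule that[rotated])
qed

section \<open>Ekeland's variational principle\<close>

text \<open>
  The relation \<open>F(z) + \<kappa> d(x,z) \<le> F(x)\<close> is a closed preorder. A greedy sequence, which at each step takes an
  almost minimal value of \<open>F\<close> among its successors, is Cauchy because its steps are paid for by the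
  decrease of \<open>F\<close>. Its limit has no successor of smaller value.
\<close>
theorem Ekeland_variational_principle:
  fixes F :: "'a::complete_space \<Rightarrow> real"
  assumes lsc: "\<And>c. closed {x. F x \<le> c}"
    and bdd: "\<And>x. m \<le> F x"
    and \<kappa>: "\<kappa> > 0"
  obtains x where "F x + \<kappa> * dist x0 x \<le> F x0" "\<And>z. F x \<le> F z + \<kappa> * dist x z"
proof -
  define T where "T = (\<lambda>x. {z. F z + \<kappa> * dist x z \<le> F x})"
  have T_refl: "x \<in> T x" for x by (simp add: T_def)
  have T_trans: "z \<in> T x" if "y \<in> T x" "z \<in> T y" for x y z
  proof -
    have "\<kappa> * dist x z \<le> \<kappa> * dist x y + \<kappa> * dist y z"
      using \<kappa> mult_left_mono[OF dist_triangle[of x z y], of \<kappa>] by (simp add: distrib_left)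
    with that show ?thesis by (auto simp: T_def)
  qed
  have bddF: "bdd_below (F ` A)" for A
    using bdd by (intro bdd_belowI[of _ m]) auto
  have "\<exists>z\<in>T x. \<forall>w\<in>T x. F z \<le> F w + (1/2) ^ n" for n :: nat and x
  proof -
    have "Inf (F ` T x) < Inf (F ` T x) + (1/2) ^ n" by simp
    then obtain z where z: "z \<in> T x" "F z < Inf (F ` T x) + (1/2) ^ n"
      using T_refl by (subst (asm) cInf_less_iff[OF _ bddF]) auto
    have "Inf (F ` T x) \<le> F w" if "w \<in> T x" for w
      using that bddF by (intro cInf_lower) auto
    with z show ?thesis by (intro bexI[of _ z]) fastforce+
  qed
  then have ex: "\<exists>z. z \<in> T x \<and> (\<forall>w\<in>T x. F z \<le> F w + (1/2) ^ n)" for n :: nat and x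
    by blast
  define g where "g = (\<lambda>n x. SOME z. z \<in> T x \<and> (\<forall>w\<in>T x. F z \<le> F w + (1/2) ^ (n::nat)))"
  have g: "g n x \<in> T x" "w \<in> T x \<Longrightarrow> F (g n x) \<le> F w + (1/2) ^ n" for n x w
    using someI_ex[OF ex[of x n]] unfolding g_def by blast+
  \<comment> \<open>The greedy sequence, with tolerance \<open>2\<^sup>-\<^sup>n\<close> in step \<open>n\<close>.\<close>
  define y where "y = rec_nat x0 g"
  have y0: "y 0 = x0" and yT: "y (Suc n) \<in> T (y n)"
    and ymin: "z \<in> T (y n) \<Longrightarrow> F (y (Suc n)) \<le> F z + (1/2) ^ n" for n z
    using g by (simp_all add: y_def)
  have yTm: "y m \<in> T (y n)" if "n \<le> m" for n m
    using that by (induction rule: dec_induct) (auto intro: T_refl T_trans yT)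
  then have dist_y: "\<kappa> * dist (y n) (y m) \<le> F (y n) - F (y m)" if "n \<le> m" for n m
    using that by (fastforce simp: T_def)
  have "decseq (\<lambda>n. F (y n))"
    using dist_y \<kappa> by (intro decseq_SucI) (smt (verit) le_SucI mult_nonneg_nonneg order_refl zero_le_dist)
  then obtain L where L: "(\<lambda>n. F (y n)) \<longlonglongrightarrow> L" and L_le: "\<And>n. L \<le> F (y n)"
    using decseq_convergent[of "\<lambda>n. F (y n)" m] bdd by metis
  have "Cauchy y"
  proof (rule metric_CauchyI)
    fix e :: real assume "e > 0"
    then have "\<kappa> * e / 2 > 0" using \<kappa> by simp
    then have "eventually (\<lambda>n. F (y n) < L + \<kappa> * e / 2) sequentially"
      using L by (intro order_tendstoD) auto
    then obtain N where N: "F (y N) < L + \<kappa> * e / 2" by (auto simp: eventually_sequentially)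
    have d: "dist (y N) (y n) < e / 2" if "n \<ge> N" for n
    proof -
      have "\<kappa> * dist (y N) (y n) < \<kappa> * (e / 2)"
        using dist_y[OF that] N L_le[of n] by simp
      then show ?thesis using \<kappa> by simp
    qed
    have "dist (y a) (y b) < e" if "a \<ge> N" "b \<ge> N" for a b
      using dist_triangle_half_r[OF d[OF that(1)] d[OF that(2)]] .
    then show "\<exists>M. \<forall>a\<ge>M. \<forall>b\<ge>M. dist (y a) (y b) < e" by blast
  qed
  then obtain x where x: "y \<longlonglongrightarrow> x" using Cauchy_convergent_iff convergent_def by blast
  \<comment> \<open>As \<open>F\<close> is only lower semicontinuous, the distance term is first relaxed by \<open>\<delta>\<close>, to be left
    constant while passing to the limit in a sublevel set of \<open>F\<close>.\<close>
  have xT: "x \<in> T (y n)" for n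
  proof -
    have "F x \<le> F (y n) - \<kappa> * (dist (y n) x - \<delta>)" if "\<delta> > 0" for \<delta>
    proof -
      have "(\<lambda>m. dist (y n) (y m)) \<longlonglongrightarrow> dist (y n) x" using x by (intro tendsto_intros)
      then have "eventually (\<lambda>m. dist (y n) x - \<delta> < dist (y n) (y m)) sequentially"
        using that by (intro order_tendstoD) auto
      then have "eventually (\<lambda>m. y m \<in> {z. F z \<le> F (y n) - \<kappa> * (dist (y n) x - \<delta>)}) sequentially"
        using eventually_ge_at_top[of n]
      proof eventually_elim
        case (elim m)
        then have "\<kappa> * (dist (y n) x - \<delta>) \<le> \<kappa> * dist (y n) (y m)"
          using \<kappa> by (intro mult_left_mono) auto
        with dist_y[OF elim(2)] show ?case by auto
      qed
      then show ?thesis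
        using Lim_in_closed_set[OF lsc _ _ x] by auto
    qed
    then have *: "F x \<le> F (y n) - \<kappa> * dist (y n) x + \<kappa> * \<delta>" if "\<delta> > 0" for \<delta>
      using that by (simp add: algebra_simps)
    have "F x \<le> F (y n) - \<kappa> * dist (y n) x"
    proof (rule field_le_epsilon)
      fix e :: real assume "e > 0"
      with *[of "e / \<kappa>"] \<kappa> show "F x \<le> F (y n) - \<kappa> * dist (y n) x + e" by simp
    qed
    then show ?thesis by (simp add: T_def)
  qed
  have "F x \<le> F z + \<kappa> * dist x z" for z
  proof (rule ccontr)
    assume "\<not> ?thesis"
    then have "z \<in> T x" by (simp add: T_def)
    have "0 \<le> \<kappa> * dist x z" using \<kappa> by simp
    with \<open>\<not> ?thesis\<close> have "F z < F x" by linarith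
    have "F (y (Suc n)) \<le> F z + (1/2) ^ n" for n
      using T_trans[OF xT \<open>z \<in> T x\<close>] by (rule ymin)
    note below_z = this
    have "(\<lambda>n. F z + (1/2) ^ n) \<longlonglongrightarrow> F z + 0"
      by (intro tendsto_intros LIMSEQ_power_zero) simp
    with LIMSEQ_Suc[OF L] have "L \<le> F z + 0"
      by (rule LIMSEQ_le) (use below_z in blast)
    moreover have "F x \<le> F (y n)" for n
    proof -
      have "0 \<le> \<kappa> * dist (y n) x" using \<kappa> by simp
      with xT[of n] show ?thesis unfolding T_def by simp
    qed
    then have "F x \<le> L" using L by (intro LIMSEQ_le_const) auto
    ultimately show False using \<open>F z < F x\<close> by simp
  qed
  moreover have "F x + \<kappa> * dist x0 x \<le> F x0"
    using xT[of 0] y0 by (simp add: T_def)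
  ultimately show ?thesis by (rule that[rotated])
qed

section \<open>Conjugates that are finite everywhere\<close>

lemma closed_conjugate_sublevel:
  fixes E :: "('a::real_normed_vector \<times> real) set"
  shows "closed {\<phi> :: 'a \<Rightarrow>\<^sub>L real. \<forall>(u, s)\<in>E. \<phi> u - s \<le> c}"
proof -
  have "{\<phi> :: 'a \<Rightarrow>\<^sub>L real. \<forall>(u, s)\<in>E. \<phi> u - s \<le> c} = (\<Inter>(u, s)\<in>E. {\<phi>. blinfun_apply \<phi> u - s \<le> c})"
    by fast
  moreover have "closed {\<phi> :: 'a \<Rightarrow>\<^sub>L real. \<phi> u - s \<le> c}" for u s
    by (intro closed_Collect_le continuous_intros)
  ultimately show ?thesis by auto
qed

text \<open>
  The condition on \<open>\<psi>\<close> says that the conjugate of a function with graph or epigraph \<open>E\<close> is at most \<open>M\<close> at \<open>\<psi>\<close>.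
  By Baire's theorem some closed sublevel set of the conjugate contains a ball, with centre \<open>z\<close>;
  averaging this ball with the reflected point \<open>2\<phi> - z\<close> moves the bound to a ball around \<open>\<phi>\<close>.
\<close>
lemma conjugate_locally_bounded:
  fixes E :: "('a::real_normed_vector \<times> real) set" and \<phi> :: "'a \<Rightarrow>\<^sub>L real"
  assumes fin: "\<And>\<phi> :: 'a \<Rightarrow>\<^sub>L real. \<exists>c. \<forall>(u, s)\<in>E. \<phi> u - s \<le> c"
  shows "\<exists>\<rho>>0. \<exists>M. \<forall>\<psi>. dist \<psi> \<phi> < \<rho> \<longrightarrow> (\<forall>(u, s)\<in>E. blinfun_apply \<psi> u - s \<le> M)"
proof -
  define A where "A = (\<lambda>n::nat. {\<phi> :: 'a \<Rightarrow>\<^sub>L real. \<forall>(u, s)\<in>E. \<phi> u - s \<le> real n})"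
  have "\<Union>(range A) = UNIV"
  proof -
    have "\<psi> \<in> \<Union>(range A)" for \<psi>
    proof -
      obtain c where c: "\<forall>(u, s)\<in>E. \<psi> u - s \<le> c" using fin by blast
      obtain n where "c \<le> real n" using real_arch_simple by blast
      with c have "\<psi> \<in> A n" by (fastforce simp: A_def)
      then show ?thesis by blast
    qed
    then show ?thesis by blast
  qed
  moreover have "closed (A n)" for n
    unfolding A_def by (rule closed_conjugate_sublevel)
  ultimately have "\<exists>n. interior (A n) \<noteq> {}"
    using Baire_category_alt[of euclidean "range A"]
    by (simp add: completely_metrizable_space_euclidean) blast
  then obtain n where "interior (A n) \<noteq> {}" by blast
  then obtain z where "z \<in> interior (A n)" by blast
  then obtain e where e: "e > 0" "ball z e \<subseteq> A n"
    unfolding mem_interior by blast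
  define w where "w = 2 *\<^sub>R \<phi> - z"
  obtain c where c: "\<forall>(u, s)\<in>E. w u - s \<le> c" using fin by blast
  have "\<psi> u - s \<le> (real n + c) / 2" if \<psi>: "dist \<psi> \<phi> < e / 2" and E: "(u, s) \<in> E" for \<psi> u s
  proof -
    have "dist z (2 *\<^sub>R \<psi> - w) = dist (2 *\<^sub>R \<psi>) (2 *\<^sub>R \<phi>)"
      by (simp add: w_def dist_norm norm_minus_commute)
    also have "\<dots> < e" using \<psi> by (simp add: dist_norm flip: scaleR_diff_right)
    finally have "2 *\<^sub>R \<psi> - w \<in> A n" using e(2) by (simp add: subset_eq)
    with E have "2 * \<psi> u - w u - s \<le> real n"
      by (auto simp: A_def blinfun.diff_left blinfun.scaleR_left)
    moreover have "w u - s \<le> c" using c E by blast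
    ultimately show ?thesis by simp
  qed
  then show ?thesis
    using e(1) by (intro exI[of _ "e / 2"] conjI exI[of _ "(real n + c) / 2"]) auto
qed

section \<open>Strong minima of all linear perturbations\<close>

text \<open>
  The minimality of \<open>p(\<phi> + t \<eta>)\<close> for the tilted function bounds its excess for \<open>\<phi>\<close> by
  \<open>t \<parallel>\<eta>\<parallel> \<parallel>p(\<phi> + t \<eta>) - p(\<phi>)\<parallel>\<close>. Local boundedness of the conjugate near \<open>\<phi>\<close> forces the excess of any point
  \<open>u\<close> to be at least a multiple of \<open>\<parallel>u - p(\<phi>)\<parallel>\<close> up to a constant, so the distances stay bounded for small
  \<open>t\<close> and the excess tends to zero.
\<close>
lemma strong_minimizers_radially_continuous:
  fixes j :: "'a::real_normed_vector \<Rightarrow> real" and p :: "('a \<Rightarrow>\<^sub>L real) \<Rightarrow> 'a"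
  assumes pD: "\<And>\<phi>. p \<phi> \<in> D"
    and min: "\<And>\<phi> u. u \<in> D \<Longrightarrow> j (p \<phi>) - blinfun_apply \<phi> (p \<phi>) \<le> j u - blinfun_apply \<phi> u"
    and strong: "\<And>\<phi> y. \<lbrakk>\<And>n. y n \<in> D;
        (\<lambda>n. j (y n) - blinfun_apply \<phi> (y n)) \<longlonglongrightarrow> j (p \<phi>) - blinfun_apply \<phi> (p \<phi>)\<rbrakk>
      \<Longrightarrow> y \<longlonglongrightarrow> p \<phi>"
    and t: "t \<longlonglongrightarrow> 0" "\<And>n. t n \<ge> 0"
  shows "(\<lambda>n. p (\<phi> + t n *\<^sub>R \<eta>)) \<longlonglongrightarrow> p \<phi>"
proof -
  define y where "y = (\<lambda>n. p (\<phi> + t n *\<^sub>R \<eta>))"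
  define g where "g = (\<lambda>u. (j u - \<phi> u) - (j (p \<phi>) - \<phi> (p \<phi>)))"
  have gap: "g (y n) \<le> t n * (norm \<eta> * norm (y n - p \<phi>))" for n
  proof -
    have "g (y n) \<le> t n * \<eta> (y n - p \<phi>)"
      using min[OF pD, of "\<phi> + t n *\<^sub>R \<eta>" \<phi>]
      by (simp add: g_def y_def blinfun.add_left blinfun.scaleR_left blinfun.diff_right algebra_simps)
    also have "\<eta> (y n - p \<phi>) \<le> norm \<eta> * norm (y n - p \<phi>)"
      using norm_blinfun[of \<eta> "y n - p \<phi>"] by simp
    finally show ?thesis using t(2)[of n] by (simp add: mult_left_mono)
  qed
  have fin: "\<exists>c. \<forall>(u, s)\<in>(\<lambda>u. (u, j u)) ` D. \<psi> u - s \<le> c" for \<psi> :: "'a \<Rightarrow>\<^sub>L real"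
    using min[of _ \<psi>] by (intro exI[of _ "\<psi> (p \<psi>) - j (p \<psi>)"]) fastforce
  obtain \<rho> M where \<rho>: "\<rho> > 0"
    and M: "\<forall>\<psi>. dist \<psi> \<phi> < \<rho> \<longrightarrow> (\<forall>(u, s)\<in>(\<lambda>u. (u, j u)) ` D. blinfun_apply \<psi> u - s \<le> M)"
    using conjugate_locally_bounded[OF fin, of \<phi>] by blast
  define B where "B = M + \<rho> / 2 * norm (p \<phi>) + (j (p \<phi>) - \<phi> (p \<phi>))"
  have growth: "\<rho> / 2 * norm (u - p \<phi>) \<le> B + g u" if "u \<in> D" for u
  proof -
    \<comment> \<open>Tilting \<open>\<phi>\<close> by half the admissible radius in the direction that norms \<open>u - p(\<phi>)\<close>.\<close>
    obtain b :: "'a \<Rightarrow>\<^sub>L real" where b: "norm b \<le> 1" "b (u - p \<phi>) = norm (u - p \<phi>)"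
      by (rule norming_functional)
    have "norm ((\<rho> / 2) *\<^sub>R b) < \<rho>"
      using b(1) \<rho> mult_left_mono[of "norm b" 1 "\<rho> / 2"] by simp
    then have "(\<phi> + (\<rho> / 2) *\<^sub>R b) u - j u \<le> M"
      using M[rule_format, of "\<phi> + (\<rho> / 2) *\<^sub>R b" "(u, j u)"] that by (simp add: dist_norm)
    moreover have "- b (p \<phi>) \<le> norm (p \<phi>)"
      using norm_blinfun[of b "p \<phi>"] b(1) mult_right_mono[of "norm b" 1 "norm (p \<phi>)"] by simp
    then have "b u \<ge> norm (u - p \<phi>) - norm (p \<phi>)"
      using b(2) by (simp add: blinfun.diff_right)
    then have "\<rho> / 2 * b u \<ge> \<rho> / 2 * (norm (u - p \<phi>) - norm (p \<phi>))"
      using \<rho> by (intro mult_left_mono) auto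
    ultimately show ?thesis
      by (simp add: B_def g_def blinfun.add_left blinfun.scaleR_left algebra_simps)
  qed
  have "(\<lambda>n. t n * norm \<eta>) \<longlonglongrightarrow> 0 * norm \<eta>"
    by (intro tendsto_intros t)
  then have ev: "eventually (\<lambda>n. t n * norm \<eta> < \<rho> / 4) sequentially"
    using \<rho> by (intro order_tendstoD) auto
  have bnd: "eventually (\<lambda>n. g (y n) \<le> t n * (norm \<eta> * (4 * B / \<rho>))) sequentially"
    using ev
  proof eventually_elim
    case (elim n)
    have yD: "y n \<in> D" unfolding y_def by (rule pD)
    have "t n * norm \<eta> * norm (y n - p \<phi>) \<le> \<rho> / 4 * norm (y n - p \<phi>)"
      using elim by (intro mult_right_mono) auto
    with growth[OF yD] gap[of n] have "\<rho> / 4 * norm (y n - p \<phi>) \<le> B"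
      by (simp add: mult.assoc)
    then have "norm (y n - p \<phi>) \<le> 4 * B / \<rho>"
      using \<rho> by (simp add: field_simps)
    then have "t n * (norm \<eta> * norm (y n - p \<phi>)) \<le> t n * (norm \<eta> * (4 * B / \<rho>))"
      using t(2)[of n] by (intro mult_left_mono) auto
    with gap[of n] show ?case by linarith
  qed
  have "(\<lambda>n. t n * (norm \<eta> * (4 * B / \<rho>))) \<longlonglongrightarrow> 0 * (norm \<eta> * (4 * B / \<rho>))"
    by (intro tendsto_intros t)
  then have "(\<lambda>n. g (y n)) \<longlonglongrightarrow> 0"
    using bnd min[OF pD, of \<phi>]
    by (intro tendsto_sandwich[of "\<lambda>_. 0" "\<lambda>n. g (y n)"]) (auto simp: g_def y_def)
  then have "(\<lambda>n. j (y n) - \<phi> (y n)) \<longlonglongrightarrow> j (p \<phi>) - \<phi> (p \<phi>)"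
    unfolding g_def by (simp add: LIM_zero_iff)
  then show ?thesis
    using strong[of y \<phi>] pD by (simp add: y_def)
qed

text \<open>
  The hypothesis on \<open>c\<close> says that the biconjugate at \<open>x\<close> is at most \<open>c\<close>, so the claim is the part of the
  Fenchel--Moreau theorem that otherwise depends on convexity; convexity of \<open>j\<close> is a consequence.
  The function \<open>F\<close> below is the conjugate minus evaluation at \<open>x\<close>; its slope at \<open>\<phi>\<close> in direction
  \<open>\<eta>\<close> is \<open>\<eta>(p(\<phi>) - x)\<close>, and Ekeland's principle makes this small.
\<close>
theorem biconjugate_of_strong_minimizers:
  fixes j :: "'a::real_normed_vector \<Rightarrow> real" and p :: "('a \<Rightarrow>\<^sub>L real) \<Rightarrow> 'a"
  assumes pD: "\<And>\<phi>. p \<phi> \<in> D"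
    and min: "\<And>\<phi> u. u \<in> D \<Longrightarrow> j (p \<phi>) - blinfun_apply \<phi> (p \<phi>) \<le> j u - blinfun_apply \<phi> u"
    and strong: "\<And>\<phi> y. \<lbrakk>\<And>n. y n \<in> D;
        (\<lambda>n. j (y n) - blinfun_apply \<phi> (y n)) \<longlonglongrightarrow> j (p \<phi>) - blinfun_apply \<phi> (p \<phi>)\<rbrakk>
      \<Longrightarrow> y \<longlonglongrightarrow> p \<phi>"
    and lsc: "\<And>c. closed {u \<in> D. j u \<le> c}"
    and le: "\<And>\<phi>. blinfun_apply \<phi> x - (blinfun_apply \<phi> (p \<phi>) - j (p \<phi>)) \<le> c"
  shows "x \<in> D \<and> j x \<le> c"
proof -
  define F where "F = (\<lambda>\<phi> :: 'a \<Rightarrow>\<^sub>L real. \<phi> (p \<phi>) - j (p \<phi>) - \<phi> x)"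
  have F_ge: "- c \<le> F \<phi>" for \<phi>
    using le[of \<phi>] by (simp add: F_def)
  have F_le_iff: "F \<phi> \<le> a \<longleftrightarrow> (\<forall>(u, s)\<in>(\<lambda>u. (u - x, j u)) ` D. \<phi> u - s \<le> a)" for \<phi> a
  proof
    assume "F \<phi> \<le> a"
    then show "\<forall>(u, s)\<in>(\<lambda>u. (u - x, j u)) ` D. \<phi> u - s \<le> a"
      using min[of _ \<phi>] by (fastforce simp: F_def blinfun.diff_right)
  next
    assume "\<forall>(u, s)\<in>(\<lambda>u. (u - x, j u)) ` D. \<phi> u - s \<le> a"
    then show "F \<phi> \<le> a" using pD[of \<phi>] by (auto simp: F_def blinfun.diff_right)
  qed
  have F_lsc: "closed {\<phi>. F \<phi> \<le> a}" for a
    unfolding F_le_iff by (rule closed_conjugate_sublevel)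
  have near: "\<exists>d\<in>D. dist d x \<le> \<epsilon> \<and> j d \<le> c + 2 * \<epsilon>" if \<epsilon>: "\<epsilon> > 0" for \<epsilon>
  proof -
    have bddF: "bdd_below (range F)" using F_ge by (intro bdd_belowI[of _ "- c"]) auto
    obtain z where z: "F z < Inf (range F) + \<epsilon>"
      using \<epsilon> cInf_less_iff[OF _ bddF, of "Inf (range F) + \<epsilon>"] by auto
    \<comment> \<open>The value \<open>j(p(\<phi>))\<close> involves \<open>\<phi>(p(\<phi>) - x)\<close>, and \<open>\<phi>\<close> may be large. The Ekeland slope \<open>\<kappa>\<close> is
      therefore scaled by the norm of the starting point, so that \<open>\<parallel>\<phi>\<parallel> \<kappa>\<close> stays of order \<open>\<epsilon>\<close>.\<close>
    define r where "r = max 1 (norm z)"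
    define \<kappa> where "\<kappa> = \<epsilon> / r"
    have r: "r \<ge> 1" "norm z \<le> r" by (auto simp: r_def)
    have \<kappa>: "\<kappa> > 0" "\<kappa> \<le> \<epsilon>" "\<kappa> * r = \<epsilon>" using r \<epsilon> by (auto simp: \<kappa>_def field_simps)
    obtain \<phi> where \<phi>: "F \<phi> + \<kappa> * dist z \<phi> \<le> F z" "\<And>\<psi>. F \<phi> \<le> F \<psi> + \<kappa> * dist \<phi> \<psi>"
      using Ekeland_variational_principle[OF F_lsc F_ge \<kappa>(1), of z] by metis
    have "Inf (range F) \<le> F \<phi>" using bddF by (intro cInf_lower) auto
    then have "\<kappa> * dist z \<phi> < \<kappa> * r" using \<phi>(1) z \<kappa> by linarith
    then have "dist z \<phi> < r" using \<kappa>(1) by simp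
    then have norm_\<phi>: "norm \<phi> \<le> 2 * r"
      using r(2) norm_triangle_ineq2[of \<phi> z] by (simp add: dist_norm norm_minus_commute)
    have dist_p: "dist (p \<phi>) x \<le> \<kappa>"
    proof -
      obtain b :: "'a \<Rightarrow>\<^sub>L real" where b: "norm b \<le> 1" "b (p \<phi> - x) = norm (p \<phi> - x)"
        by (rule norming_functional)
      define t where "t = (\<lambda>n. inverse (real (Suc n)))"
      have t: "t \<longlonglongrightarrow> 0" "\<And>n. t n \<ge> 0" "\<And>n. t n > 0"
        unfolding t_def using LIMSEQ_inverse_real_of_nat by auto
      define y where "y = (\<lambda>n. p (\<phi> + t n *\<^sub>R (- b)))"
      have y: "y \<longlonglongrightarrow> p \<phi>"
        unfolding y_def using t by (intro strong_minimizers_radially_continuous[OF pD min strong]) auto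
      have "b (y n - x) \<le> \<kappa>" for n
      proof -
        have "F \<phi> \<le> F (\<phi> + t n *\<^sub>R (- b)) + \<kappa> * dist \<phi> (\<phi> + t n *\<^sub>R (- b))" by (rule \<phi>)
        also have "dist \<phi> (\<phi> + t n *\<^sub>R (- b)) \<le> t n"
          using b(1) t(2)[of n] mult_left_mono[of "norm b" 1 "t n"] by (simp add: dist_norm)
        also have "F (\<phi> + t n *\<^sub>R (- b)) = \<phi> (y n) - j (y n) - \<phi> x - t n * b (y n - x)"
          by (simp add: F_def y_def blinfun.add_left blinfun.scaleR_left blinfun.minus_left
              blinfun.diff_left blinfun.diff_right algebra_simps)
        also have "\<phi> (y n) - j (y n) - \<phi> x \<le> F \<phi>"
          using min[of "y n" \<phi>] pD by (simp add: F_def y_def)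
        finally have "t n * b (y n - x) \<le> t n * \<kappa>"
          using \<kappa>(1) by (simp add: mult.commute)
        then show ?thesis using t(3)[of n] by simp
      qed
      moreover have "(\<lambda>n. b (y n - x)) \<longlonglongrightarrow> b (p \<phi> - x)"
        by (intro tendsto_intros y)
      ultimately have "b (p \<phi> - x) \<le> \<kappa>" by (intro LIMSEQ_le_const2) auto
      with b(2) show ?thesis by (simp add: dist_norm)
    qed
    have "j (p \<phi>) = \<phi> (p \<phi> - x) - F \<phi>" by (simp add: F_def blinfun.diff_right)
    also have "\<phi> (p \<phi> - x) \<le> norm \<phi> * dist (p \<phi>) x"
      using norm_blinfun[of \<phi> "p \<phi> - x"] by (simp add: dist_norm)
    also have "\<dots> \<le> (2 * r) * \<kappa>"
      using norm_\<phi> dist_p r by (intro mult_mono) auto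
    also have "\<dots> = 2 * \<epsilon>" using \<kappa> by (simp add: algebra_simps)
    finally have "j (p \<phi>) \<le> c + 2 * \<epsilon>" using F_ge[of \<phi>] by simp
    with pD dist_p \<kappa> show ?thesis by (meson order_trans)
  qed
  have approx: "x \<in> {u \<in> D. j u \<le> c + \<delta>}" if "\<delta> > 0" for \<delta>
  proof -
    have "x \<in> closure {u \<in> D. j u \<le> c + \<delta>}"
      unfolding closure_approachable
    proof (intro allI impI)
      fix e :: real assume "e > 0"
      define \<epsilon> where "\<epsilon> = min (\<delta> / 2) (e / 2)"
      have "\<epsilon> > 0" "2 * \<epsilon> \<le> \<delta>" "\<epsilon> < e" using that \<open>e > 0\<close> by (auto simp: \<epsilon>_def)
      with near[of \<epsilon>] show "\<exists>d\<in>{u \<in> D. j u \<le> c + \<delta>}. dist d x < e" by force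
    qed
    then show ?thesis by (simp only: closure_closed[OF lsc])
  qed
  show ?thesis
  proof
    show "x \<in> D" using approx[of 1] by simp
    show "j x \<le> c" by (rule field_le_epsilon) (use approx in simp)
  qed
qed

section \<open>Firmness and linear growth\<close>

text \<open>
  A convex function that vanishes at \<open>0\<close> lies above its chord beyond \<open>r\<close>. The minimum with \<open>1\<close> covers the
  case \<open>\<psi> r = \<infinity>\<close>.
\<close>
lemma Gamma0_linear_growth:
  assumes \<psi>: "\<psi> \<in> Gamma0" and r: "r > 0"
  obtains c where "c > 0" "\<And>t. t \<ge> r \<Longrightarrow> ereal (c * t) \<le> \<psi> t"
proof -
  have conv: "\<psi> ((1 - \<theta>) *\<^sub>R s + \<theta> *\<^sub>R t) \<le> ereal (1 - \<theta>) * \<psi> s + ereal \<theta> * \<psi> t"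
    if "s \<ge> 0" "t \<ge> 0" "0 < \<theta>" "\<theta> < 1" for s t \<theta>
    using \<psi> that unfolding Gamma0_def ereal_convex_on_def by auto
  have \<psi>0: "\<psi> 0 = 0" and \<psi>r: "0 < \<psi> r"
    using \<psi> r unfolding Gamma0_def by (auto simp: less_le)
  have "\<exists>m. ereal m = min 1 (\<psi> r)"
    using \<psi>r by (cases "\<psi> r"; cases "1 \<le> \<psi> r") (auto simp: min_def one_ereal_def)
  then obtain m where m: "ereal m = min 1 (\<psi> r)" by blast
  have m_pos: "m > 0" and m_le: "ereal m \<le> \<psi> r"
    using m \<psi>r by (auto simp flip: ereal_less(2))
  show ?thesis
  proof (rule that)
    show "m / r > 0" using m_pos r by simp
    fix t assume t: "t \<ge> r"
    show "ereal (m / r * t) \<le> \<psi> t"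
    proof (cases "t = r")
      case False
      then have \<theta>: "0 < r / t" "r / t < 1" "t > 0" using t r by auto
      have "ereal m \<le> ereal (r / t) * \<psi> t"
        using m_le conv[of 0 t "r / t"] \<theta> \<psi>0 by simp
      then show ?thesis
        using \<theta> r by (cases "\<psi> t") (auto simp: field_simps)
    qed (use m_le r in auto)
  qed
qed

text \<open>
  Conversely, growth at a positive linear rate outside each radius \<open>r\<close> is enough for a gauge in \<^const>\<open>Gamma0\<close>:
  the supremum over \<open>r\<close> of the hinge functions \<open>c r * max 0 (t - r)\<close> is convex and lower semicontinuous,
  and is positive at \<open>t > 0\<close> because of the hinge at \<open>t / 2\<close>.
\<close>
lemma Gamma0_minorant_of_linear_growth:
  fixes G :: "'a \<Rightarrow> ereal" and d :: "'a \<Rightarrow> real"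
  assumes growth: "\<And>r. r > 0 \<Longrightarrow> \<exists>c>0. \<forall>u. r \<le> d u \<longrightarrow> ereal (c * d u) \<le> G u"
    and nonneg: "\<And>u. 0 \<le> G u"
  obtains \<psi> where "\<psi> \<in> Gamma0" "\<And>u. \<psi> (d u) \<le> G u"
proof -
  obtain c where c: "\<And>r. r > 0 \<Longrightarrow> c r > 0 \<and> (\<forall>u. r \<le> d u \<longrightarrow> ereal (c r * d u) \<le> G u)"
    using growth by metis
  define h where "h = (\<lambda>r t. c r * max 0 (t - r))"
  define \<psi> where "\<psi> = (\<lambda>t. SUP r\<in>{0<..}. ereal (h r t))"
  have h_nonneg: "0 \<le> h r t" if "r > 0" for r t
    using c[OF that] by (simp add: h_def)
  have h_le: "ereal (h r t) \<le> \<psi> t" if "r > 0" for r t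
    unfolding \<psi>_def using that by (intro SUP_upper) auto
  have "lsc_on {0..} \<psi>"
    unfolding lsc_on_def le_Liminf_iff
  proof (intro ballI allI impI)
    fix t a assume "a < \<psi> t"
    then obtain r where r: "r > 0" "a < ereal (h r t)"
      unfolding \<psi>_def less_SUP_iff by auto
    have "((\<lambda>t. ereal (h r t)) \<longlongrightarrow> ereal (h r t)) (at t within {0..})"
      unfolding h_def by (intro tendsto_intros)
    then have "\<forall>\<^sub>F t in at t within {0..}. a < ereal (h r t)"
      using r(2) by (rule order_tendstoD)
    then show "\<forall>\<^sub>F t in at t within {0..}. a < \<psi> t"
      by eventually_elim (use h_le[OF r(1)] in \<open>blast intro: less_le_trans\<close>)
  qed
  moreover have "ereal_convex_on {0..} \<psi>"
    unfolding ereal_convex_on_def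
  proof (intro conjI ballI allI impI)
    fix x y t :: real assume t: "0 < t \<and> t < 1"
    show "\<psi> ((1 - t) *\<^sub>R x + t *\<^sub>R y) \<le> ereal (1 - t) * \<psi> x + ereal t * \<psi> y"
      unfolding \<psi>_def[THEN fun_cong, of "(1 - t) *\<^sub>R x + t *\<^sub>R y"]
    proof (rule SUP_least)
      fix r :: real assume "r \<in> {0<..}"
      then have r: "r > 0" by simp
      have "(1 - t) * max 0 (x - r) \<ge> (1 - t) * (x - r)" "t * max 0 (y - r) \<ge> t * (y - r)"
        "(1 - t) * max 0 (x - r) \<ge> 0" "t * max 0 (y - r) \<ge> 0"
        using t by (auto intro: mult_left_mono)
      moreover have "(1 - t) *\<^sub>R x + t *\<^sub>R y - r = (1 - t) * (x - r) + t * (y - r)"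
        by (simp add: algebra_simps)
      ultimately have "max 0 ((1 - t) *\<^sub>R x + t *\<^sub>R y - r) \<le> (1 - t) * max 0 (x - r) + t * max 0 (y - r)"
        by (intro max.boundedI) linarith+
      then have "c r * max 0 ((1 - t) *\<^sub>R x + t *\<^sub>R y - r)
          \<le> c r * ((1 - t) * max 0 (x - r) + t * max 0 (y - r))"
        using c[OF r] by (intro mult_left_mono) auto
      then have "h r ((1 - t) *\<^sub>R x + t *\<^sub>R y) \<le> (1 - t) * h r x + t * h r y"
        by (simp add: h_def algebra_simps)
      then have "ereal (h r ((1 - t) *\<^sub>R x + t *\<^sub>R y)) \<le> ereal (1 - t) * h r x + ereal t * h r y"
        by simp
      also have "\<dots> \<le> ereal (1 - t) * \<psi> x + ereal t * \<psi> y"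
        using t h_le[OF r] by (intro add_mono ereal_mult_left_mono) auto
      finally show "ereal (h r ((1 - t) *\<^sub>R x + t *\<^sub>R y)) \<le> ereal (1 - t) * \<psi> x + ereal t * \<psi> y" .
    qed
  qed simp
  moreover have "0 \<le> \<psi> t" for t
    using h_le[of 1 t] h_nonneg[of 1 t] by (metis ereal_less_eq(5) order_trans zero_less_one)
  moreover have "\<psi> t = 0 \<longleftrightarrow> t = 0" if "t \<ge> 0" for t
  proof
    assume "\<psi> t = 0"
    show "t = 0"
    proof (rule ccontr)
      assume "t \<noteq> 0"
      with that have "t / 2 > 0" by simp
      from h_le[OF this, of t] c[OF this] \<open>t / 2 > 0\<close> \<open>\<psi> t = 0\<close> show False
        by (auto simp: h_def mult_le_0_iff)
    qed
  next
    assume "t = 0"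
    then have "\<psi> t = (SUP r\<in>{0::real<..}. 0)"
      unfolding \<psi>_def h_def by (intro SUP_cong) (auto simp: zero_ereal_def)
    then show "\<psi> t = 0" by simp
  qed
  ultimately have "\<psi> \<in> Gamma0" by (simp add: Gamma0_def)
  moreover have "\<psi> (d u) \<le> G u" for u
    unfolding \<psi>_def
  proof (rule SUP_least)
    fix r :: real assume "r \<in> {0<..}"
    then have r: "r > 0" by simp
    show "ereal (h r (d u)) \<le> G u"
    proof (cases "r \<le> d u")
      case True
      then have "h r (d u) \<le> c r * d u"
        using c[OF r] r by (auto simp: h_def intro!: mult_left_mono)
      then have "ereal (h r (d u)) \<le> ereal (c r * d u)" by simp
      also have "\<dots> \<le> G u" using c[OF r] True by blast
      finally show ?thesis .
    qed (use nonneg in \<open>simp add: h_def zero_ereal_def\<close>)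
  qed
  ultimately show ?thesis by (rule that)
qed

text \<open>
  The excess \<open>g\<close> over the supporting affine function has a positive infimum outside each ball around \<open>x\<close>,
  for otherwise there would be a minimizing sequence that stays away from \<open>x\<close>. Convexity along the rays
  from \<open>x\<close> turns this into linear growth.
\<close>
lemma firm_of_strong_minimum:
  fixes j :: "'a::real_normed_vector \<Rightarrow> real" and \<phi> :: "'a \<Rightarrow>\<^sub>L real"
  assumes min: "\<And>u. u \<in> D \<Longrightarrow> j x + \<phi> (u - x) \<le> j u"
    and strong: "\<And>y. \<lbrakk>\<And>n. y n \<in> D; (\<lambda>n. j (y n) - \<phi> (y n)) \<longlonglongrightarrow> j x - \<phi> x\<rbrakk> \<Longrightarrow> y \<longlonglongrightarrow> x"
    and conv: "\<And>u t. \<lbrakk>u \<in> D; 0 < t; t \<le> 1\<rbrakk> \<Longrightarrow>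
      x + t *\<^sub>R (u - x) \<in> D \<and> j (x + t *\<^sub>R (u - x)) \<le> (1 - t) * j x + t * j u"
  obtains \<psi> where "\<psi> \<in> Gamma0" "\<And>u. u \<in> D \<Longrightarrow> ereal (j x + \<phi> (u - x)) + \<psi> (norm (u - x)) \<le> ereal (j u)"
proof -
  define g where "g = (\<lambda>u. j u - j x - \<phi> (u - x))"
  define G where "G = (\<lambda>u. if u \<in> D then ereal (g u) else \<infinity>)"
  have g_nonneg: "g u \<ge> 0" if "u \<in> D" for u using min[OF that] by (simp add: g_def)
  have g_conv: "x + t *\<^sub>R (u - x) \<in> D" "g (x + t *\<^sub>R (u - x)) \<le> t * g u"
    if "u \<in> D" "0 < t" "t \<le> 1" for u t
    using conv[OF that] by (simp_all add: g_def blinfun.scaleR_right right_diff_distrib left_diff_distrib)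
  have gap: "\<exists>m>0. \<forall>u\<in>D. r \<le> norm (u - x) \<longrightarrow> m \<le> g u" if r: "r > 0" for r
  proof (rule ccontr)
    assume contra: "\<not> ?thesis"
    have "\<exists>u. u \<in> D \<and> r \<le> norm (u - x) \<and> g u < inverse (real (Suc n))" for n
      using contra[simplified, rule_format, of "inverse (real (Suc n))"]
      by (auto simp: not_le)
    then obtain y where y: "\<And>n. y n \<in> D" "\<And>n. r \<le> norm (y n - x)"
        "\<And>n. g (y n) < inverse (real (Suc n))" by metis
    have "(\<lambda>n. g (y n)) \<longlonglongrightarrow> 0"
      using y(3) g_nonneg[OF y(1)]
      by (intro tendsto_sandwich[OF _ _ tendsto_const LIMSEQ_inverse_real_of_nat]
          always_eventually allI) (auto simp del: of_nat_Suc intro: less_imp_le)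
    then have "(\<lambda>n. g (y n) + (j x - \<phi> x)) \<longlonglongrightarrow> 0 + (j x - \<phi> x)"
      by (intro tendsto_intros)
    then have "y \<longlonglongrightarrow> x" using y(1) by (intro strong) (simp_all add: g_def blinfun.diff_right)
    then have "\<forall>\<^sub>F n in sequentially. dist (y n) x < r" using r by (rule tendstoD)
    then show False using y(2) by (simp add: dist_norm not_less[symmetric])
  qed
  have "\<exists>c>0. \<forall>u. r \<le> norm (u - x) \<longrightarrow> ereal (c * norm (u - x)) \<le> G u" if r: "r > 0" for r
  proof -
    obtain m where m: "m > 0" "\<And>u. u \<in> D \<Longrightarrow> r \<le> norm (u - x) \<Longrightarrow> m \<le> g u"
      using gap[OF r] by blast
    have "m / r * norm (u - x) \<le> g u" if u: "u \<in> D" "r \<le> norm (u - x)" for u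
    proof -
      define t where "t = r / norm (u - x)"
      have t: "0 < t" "t \<le> 1" "t * norm (u - x) = r"
      proof -
        have "norm (u - x) > 0" using r u(2) by linarith
        then have "u \<noteq> x" by auto
        then show "0 < t" "t \<le> 1" "t * norm (u - x) = r"
          using r u(2) by (simp_all add: t_def divide_le_eq)
      qed
      have "m \<le> g (x + t *\<^sub>R (u - x))"
        using g_conv(1)[OF u(1) t(1,2)] t by (intro m(2)) auto
      also have "\<dots> \<le> t * g u" using g_conv(2)[OF u(1) t(1,2)] .
      finally have "m * norm (u - x) \<le> (t * g u) * norm (u - x)"
        by (intro mult_right_mono) auto
      also have "\<dots> = r * g u" using t(3) by (simp add: mult.commute mult.left_commute)
      finally show ?thesis using r by (simp add: field_simps)
    qed
    then show ?thesis
      using m(1) r by (intro exI[of _ "m / r"]) (simp add: G_def)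
  qed
  moreover have "0 \<le> G u" for u using g_nonneg by (simp add: G_def)
  ultimately obtain \<psi> where \<psi>: "\<psi> \<in> Gamma0" "\<And>u. \<psi> (norm (u - x)) \<le> G u"
    using Gamma0_minorant_of_linear_growth[of "\<lambda>u. norm (u - x)" G] by metis
  show ?thesis
  proof (rule that[OF \<psi>(1)])
    fix u assume "u \<in> D"
    then have "ereal (j x + \<phi> (u - x)) + \<psi> (norm (u - x)) \<le> ereal (j x + \<phi> (u - x)) + ereal (g u)"
      using \<psi>(2)[of u] by (intro add_left_mono) (simp add: G_def)
    then show "ereal (j x + \<phi> (u - x)) + \<psi> (norm (u - x)) \<le> ereal (j u)"
      by (simp add: g_def)
  qed
qed

section \<open>Extended-valued functions\<close>

lemma closed_sublevel_of_lsc: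
  assumes "lsc_on UNIV f"
  shows "closed {x. f x \<le> a}"
proof -
  have "open {x. a < f x}"
  proof (subst open_subopen, safe)
    fix x assume "a < f x"
    also have "f x \<le> Liminf (at x) f" using assms by (simp add: lsc_on_def)
    finally have "\<forall>\<^sub>F y in at x. a < f y" by (rule less_LiminfD)
    then obtain T where "open T" "x \<in> T" "\<And>y. y \<in> T \<Longrightarrow> y \<noteq> x \<Longrightarrow> a < f y"
      unfolding eventually_at_topological by auto
    with \<open>a < f x\<close> show "\<exists>T. open T \<and> x \<in> T \<and> T \<subseteq> {x. a < f x}" by blast
  qed
  moreover have "- {x. f x \<le> a} = {x. a < f x}" by auto
  ultimately show ?thesis by (simp add: closed_def)
qed

text \<open>
  At a minimum point the infimum is the value there, so minimizing sequences can be tested against that value.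
\<close>
lemma attains_strong_minimum_iff:
  "attains_strong_minimum I S \<longleftrightarrow> I \<in> proper_funs \<and>
    (\<exists>m\<in>S. (\<forall>x\<in>S. I m \<le> I x) \<and>
      (\<forall>y. (\<forall>n. y n \<in> S) \<and> (\<lambda>n. I (y n)) \<longlonglongrightarrow> I m \<longrightarrow> y \<longlonglongrightarrow> m))"
proof -
  have "(INF x\<in>S. I x) = I m" if "m \<in> S" "\<forall>x\<in>S. I m \<le> I x" for m
    using that by (intro antisym INF_lower INF_greatest) auto
  then show ?thesis
    unfolding attains_strong_minimum_def by (intro conj_cong bex_cong refl) simp
qed

lemma add_indicator_inf:
  assumes "f \<in> proper_funs"
  shows "f x + indicator_inf S x =
    (if x \<in> S \<inter> eff_domain f then ereal (real_of_ereal (f x)) else \<infinity>)"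
  using assms by (cases "f x") (auto simp: proper_funs_def indicator_inf_def eff_domain_def)

section \<open>Strongly Tchebychev constraint sets\<close>

text \<open>
  The strong minimum points form the map \<open>p\<close> of \<open>biconjugate_of_strong_minimizers\<close>. A convex combination of values
  of \<open>j\<close> dominates the biconjugate at the convex combination of the points, hence also \<open>j\<close> there. A point
  with a subgradient \<open>\<phi>\<close> minimizes \<open>J - \<phi>\<close> and so is \<open>p(\<phi>)\<close>, where firmness comes from the strong minimum.
\<close>
theorem essentially_firmly_subdifferentiable_of_strongly_Tchebychev:
  fixes f :: "'a::banach \<Rightarrow> ereal" and S :: "'a set"
  assumes f: "f \<in> proper_funs" "lsc_on UNIV f"
    and S: "closed S" "S \<inter> eff_domain f \<noteq> {}"
    and T: "strongly_Tchebychev f S"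
  shows "essentially_firmly_subdifferentiable (\<lambda>x. f x + indicator_inf S x)"
    and "convex (S \<inter> eff_domain f)"
proof -
  define D where "D = S \<inter> eff_domain f"
  define j where "j = (\<lambda>x. real_of_ereal (f x))"
  define J where "J = (\<lambda>x. f x + indicator_inf S x)"
  have J_eq: "J x = (if x \<in> D then ereal (j x) else \<infinity>)" for x
    unfolding J_def D_def j_def by (rule add_indicator_inf[OF f(1)])
  have f_eq: "f x = ereal (j x)" if "x \<in> D" for x
    using that f(1) by (cases "f x") (auto simp: D_def j_def eff_domain_def proper_funs_def)
  have DS: "D \<subseteq> S" by (auto simp: D_def)
  obtain d where d: "d \<in> D" using S(2) by (auto simp: D_def)
  have "\<forall>\<phi> :: 'a \<Rightarrow>\<^sub>L real. \<exists>m. m \<in> D \<and> (\<forall>u\<in>D. j m - \<phi> m \<le> j u - \<phi> u) \<and>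
      (\<forall>y. (\<forall>n. y n \<in> D) \<longrightarrow> (\<lambda>n. j (y n) - \<phi> (y n)) \<longlonglongrightarrow> j m - \<phi> m \<longrightarrow> y \<longlonglongrightarrow> m)"
  proof
    fix \<phi> :: "'a \<Rightarrow>\<^sub>L real"
    obtain m where m: "m \<in> S" "\<And>u. u \<in> S \<Longrightarrow> f m - ereal (\<phi> m) \<le> f u - ereal (\<phi> u)"
      and strong: "\<And>y. (\<forall>n. y n \<in> S) \<Longrightarrow>
        (\<lambda>n. f (y n) - ereal (\<phi> (y n))) \<longlonglongrightarrow> f m - ereal (\<phi> m) \<Longrightarrow> y \<longlonglongrightarrow> m"
      using T unfolding strongly_Tchebychev_def attains_strong_minimum_iff by meson
    have "f m - ereal (\<phi> m) \<le> ereal (j d - \<phi> d)"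
      using m(2)[of d] d DS f_eq by auto
    then have mD: "m \<in> D"
      using m(1) by (cases "f m") (auto simp: D_def eff_domain_def)
    have "j m - \<phi> m \<le> j u - \<phi> u" if "u \<in> D" for u
      using m(2)[of u] that DS f_eq mD by auto
    moreover have "y \<longlonglongrightarrow> m"
      if y: "\<forall>n. y n \<in> D" and lim: "(\<lambda>n. j (y n) - \<phi> (y n)) \<longlonglongrightarrow> j m - \<phi> m" for y
    proof (rule strong)
      show "\<forall>n. y n \<in> S" using y DS by blast
      have "(\<lambda>n. ereal (j (y n) - \<phi> (y n))) \<longlonglongrightarrow> ereal (j m - \<phi> m)" using lim by simp
      then show "(\<lambda>n. f (y n) - ereal (\<phi> (y n))) \<longlonglongrightarrow> f m - ereal (\<phi> m)"
        using f_eq y mD by simp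
    qed
    ultimately show "\<exists>m. m \<in> D \<and> (\<forall>u\<in>D. j m - \<phi> m \<le> j u - \<phi> u) \<and>
      (\<forall>y. (\<forall>n. y n \<in> D) \<longrightarrow> (\<lambda>n. j (y n) - \<phi> (y n)) \<longlonglongrightarrow> j m - \<phi> m \<longrightarrow> y \<longlonglongrightarrow> m)"
      using mD by blast
  qed
  from choice[OF this] obtain p where pD: "\<And>\<phi>. p \<phi> \<in> D"
    and min: "\<And>\<phi> u. u \<in> D \<Longrightarrow> j (p \<phi>) - blinfun_apply \<phi> (p \<phi>) \<le> j u - blinfun_apply \<phi> u"
    and strong: "\<And>\<phi> y. \<lbrakk>\<And>n. y n \<in> D; (\<lambda>n. j (y n) - blinfun_apply \<phi> (y n)) \<longlonglongrightarrow>
        j (p \<phi>) - blinfun_apply \<phi> (p \<phi>)\<rbrakk> \<Longrightarrow> y \<longlonglongrightarrow> p \<phi>"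
    by blast
  have lsc: "closed {u \<in> D. j u \<le> c}" for c
  proof -
    have "u \<in> D \<and> j u \<le> c \<longleftrightarrow> u \<in> S \<and> f u \<le> ereal c" for u
      using f_eq[of u] by (cases "u \<in> D") (auto simp: D_def eff_domain_def)
    then have "{u \<in> D. j u \<le> c} = S \<inter> {u. f u \<le> ereal c}" by blast
    then show ?thesis using S(1) closed_sublevel_of_lsc[OF f(2)] by auto
  qed
  have conv: "(1 - t) *\<^sub>R u + t *\<^sub>R v \<in> D \<and> j ((1 - t) *\<^sub>R u + t *\<^sub>R v) \<le> (1 - t) * j u + t * j v"
    if uv: "u \<in> D" "v \<in> D" and t: "0 \<le> t" "t \<le> 1" for u v t
  proof (rule biconjugate_of_strong_minimizers[OF pD min strong lsc])
    fix \<phi> :: "'a \<Rightarrow>\<^sub>L real"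
    have "(1 - t) * (j (p \<phi>) - \<phi> (p \<phi>)) \<le> (1 - t) * (j u - \<phi> u)"
      "t * (j (p \<phi>) - \<phi> (p \<phi>)) \<le> t * (j v - \<phi> v)"
      using t uv by (intro mult_left_mono min; simp)+
    then show "\<phi> ((1 - t) *\<^sub>R u + t *\<^sub>R v) - (\<phi> (p \<phi>) - j (p \<phi>)) \<le> (1 - t) * j u + t * j v"
      by (simp only: blinfun.add_right blinfun.scaleR_right) (simp add: algebra_simps)
  qed
  show "convex (S \<inter> eff_domain f)"
    using conv unfolding convex_alt D_def[symmetric] by blast
  have "ereal_convex_on UNIV J"
    unfolding ereal_convex_on_def
  proof (intro conjI ballI allI impI)
    fix u v :: 'a and t :: real assume t: "0 < t \<and> t < 1"
    show "J ((1 - t) *\<^sub>R u + t *\<^sub>R v) \<le> ereal (1 - t) * J u + ereal t * J v"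
      using conv[of u v t] t by (auto simp: J_eq)
  qed simp
  moreover have "J \<in> proper_funs"
    using d by (auto simp: proper_funs_def eff_domain_def J_eq)
  moreover have "firmly_subdifferentiable_at J x" if x: "x \<in> dom_subdifferential J" for x
    unfolding firmly_subdifferentiable_at_def
  proof (intro conjI x ballI)
    fix \<phi> assume \<phi>: "\<phi> \<in> subdifferential J x"
    then have xD: "x \<in> D" and sub: "\<And>u. J x + ereal (\<phi> (u - x)) \<le> J u"
      by (auto simp: subdifferential_def J_eq split: if_splits)
    have min_x: "j x + \<phi> (u - x) \<le> j u" if "u \<in> D" for u
      using sub[of u] that xD by (simp add: J_eq)
    have "j x - \<phi> x = j (p \<phi>) - \<phi> (p \<phi>)"
      using min_x[OF pD, of \<phi>] min[OF xD, of \<phi>] by (simp add: blinfun.diff_right)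
    then have "(\<lambda>n. x) \<longlonglongrightarrow> p \<phi>"
      using xD by (intro strong) simp_all
    then have px: "p \<phi> = x" by (simp add: LIMSEQ_const_iff)
    obtain \<psi> where \<psi>: "\<psi> \<in> Gamma0"
      "\<And>u. u \<in> D \<Longrightarrow> ereal (j x + \<phi> (u - x)) + \<psi> (norm (u - x)) \<le> ereal (j u)"
    proof (rule firm_of_strong_minimum[where D = D and j = j and x = x and \<phi> = \<phi>])
      show "y \<longlonglongrightarrow> x" if "\<And>n. y n \<in> D" "(\<lambda>n. j (y n) - \<phi> (y n)) \<longlonglongrightarrow> j x - \<phi> x" for y
        using strong[of y \<phi>] that px by simp
      show "x + t *\<^sub>R (u - x) \<in> D \<and> j (x + t *\<^sub>R (u - x)) \<le> (1 - t) * j x + t * j u"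
        if "u \<in> D" "0 < t" "t \<le> 1" for u t
        using conv[OF xD that(1), of t] that by (simp add: algebra_simps)
    qed (use min_x in auto)
    have "J x + ereal (\<phi> (u - x)) + \<psi> (norm (u - x)) \<le> J u" for u
      using \<psi>(2)[of u] xD by (simp add: J_eq)
    with \<psi>(1) show "\<exists>\<psi>\<in>Gamma0. \<forall>u. J x + ereal (\<phi> (u - x)) + \<psi> (norm (u - x)) \<le> J u"
      by blast
  qed
  ultimately show "essentially_firmly_subdifferentiable (\<lambda>x. f x + indicator_inf S x)"
    unfolding essentially_firmly_subdifferentiable_def J_def by blast
qed

section \<open>Convex duality through epigraphs\<close>

text \<open>
  Only real heights are recorded, so that the epigraph is a subset of a real vector space. The
  value \<open>\<infinity>\<close> shows as an empty fibre.
\<close>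
definition real_epigraph :: "('a \<Rightarrow> ereal) \<Rightarrow> ('a \<times> real) set"
  where "real_epigraph F = {(x, s). F x \<le> ereal s}"

lemma convex_real_epigraph:
  assumes "ereal_convex_on UNIV F"
  shows "convex (real_epigraph F)"
  unfolding convex_alt
proof safe
  fix x y :: 'a and a b t :: real
  assume xy: "(x, a) \<in> real_epigraph F" "(y, b) \<in> real_epigraph F" and t: "0 \<le> t" "t \<le> 1"
  consider "t = 0" | "t = 1" | "0 < t" "t < 1" using t by linarith
  then show "(1 - t) *\<^sub>R (x, a) + t *\<^sub>R (y, b) \<in> real_epigraph F"
  proof cases
    case 3
    then have "F ((1 - t) *\<^sub>R x + t *\<^sub>R y) \<le> ereal (1 - t) * F x + ereal t * F y"
      using assms by (auto simp: ereal_convex_on_def)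
    also have "\<dots> \<le> ereal (1 - t) * ereal a + ereal t * ereal b"
      using xy t by (intro add_mono ereal_mult_left_mono) (auto simp: real_epigraph_def)
    finally show ?thesis by (simp add: real_epigraph_def)
  qed (use xy in auto)
qed

lemma ereal_ge_of_epigraph:
  assumes "\<And>s. F x \<le> ereal s \<Longrightarrow> c \<le> s" "F x \<noteq> - \<infinity>"
  shows "ereal c \<le> F x"
  using assms by (cases "F x") auto

text \<open>
  A convex function that is bounded above near a point has a subgradient there: its epigraph contains
  the disc that \<open>subgradient_of_convex_set\<close> requires.
\<close>
lemma subdifferential_nonempty:
  fixes F :: "'a::real_normed_vector \<Rightarrow> ereal"
  assumes conv: "convex (real_epigraph F)"
    and F: "\<And>u. F u \<noteq> - \<infinity>"
    and \<rho>: "\<rho> > 0" "\<And>u. dist u x < \<rho> \<Longrightarrow> F u \<le> ereal M"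
  shows "subdifferential F x \<noteq> {}"
proof -
  have "F x \<le> ereal M" using \<rho> by simp
  then obtain r where r: "F x = ereal r" using F[of x] by (cases "F x") auto
  obtain b :: "'a \<Rightarrow>\<^sub>L real" where b: "\<And>u s. (u, s) \<in> real_epigraph F \<Longrightarrow> r + b (u - x) \<le> s"
    by (rule subgradient_of_convex_set[OF conv _ \<rho>(1), of x r M])
      (use r \<rho>(2) in \<open>auto simp: real_epigraph_def\<close>)
  have "ereal (r + b (u - x)) \<le> F u" for u
    using b F by (intro ereal_ge_of_epigraph) (auto simp: real_epigraph_def)
  then have "b \<in> subdifferential F x" by (simp add: subdifferential_def r)
  then show ?thesis by blast
qed

lemma conjugate_le_iff:
  assumes "J \<in> proper_funs"
  shows "conjugate J \<phi> \<le> ereal c \<longleftrightarrow> (\<forall>(u, s)\<in>real_epigraph J. blinfun_apply \<phi> u - s \<le> c)"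
proof -
  have "ereal (\<phi> u) - J u \<le> ereal c \<longleftrightarrow> (\<forall>s. J u \<le> ereal s \<longrightarrow> \<phi> u - s \<le> c)" for u
    using assms by (cases "J u") (auto simp: proper_funs_def intro: order_trans[rotated] diff_left_mono)
  then show ?thesis
    by (auto simp: conjugate_def SUP_le_iff real_epigraph_def)
qed

lemma convex_epigraph_conjugate:
  assumes "J \<in> proper_funs"
  shows "convex (real_epigraph (conjugate J))"
  unfolding convex_def
proof safe
  fix \<phi> \<eta> :: "'a \<Rightarrow>\<^sub>L real" and a b s t :: real
  assume *: "(\<phi>, a) \<in> real_epigraph (conjugate J)" "(\<eta>, b) \<in> real_epigraph (conjugate J)"
    "0 \<le> s" "0 \<le> t" "s + t = 1"
  have "(s *\<^sub>R \<phi> + t *\<^sub>R \<eta>) u - c \<le> s * a + t * b" if "(u, c) \<in> real_epigraph J" for u c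
  proof -
    have "s * (\<phi> u - c) \<le> s * a" "t * (\<eta> u - c) \<le> t * b"
      using * that by (auto simp: real_epigraph_def[of "conjugate J"] conjugate_le_iff[OF assms]
          intro!: mult_left_mono)
    moreover have "c = s * c + t * c" using *(5) by (metis distrib_right mult_1)
    ultimately show ?thesis
      by (simp add: blinfun.add_left blinfun.scaleR_left right_diff_distrib)
  qed
  then show "s *\<^sub>R (\<phi>, a) + t *\<^sub>R (\<eta>, b) \<in> real_epigraph (conjugate J)"
    by (auto simp: real_epigraph_def[of "conjugate J"] conjugate_le_iff[OF assms])
qed

lemma conjugate_neq_minus_infinity:
  assumes "J \<in> proper_funs"
  shows "conjugate J \<phi> \<noteq> - \<infinity>"
proof -
  obtain u where "J u < \<infinity>" "J u \<noteq> - \<infinity>" using assms by (auto simp: proper_funs_def eff_domain_def)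
  then obtain r where "J u = ereal r" by (cases "J u") auto
  then have "ereal (\<phi> u - r) \<le> conjugate J \<phi>"
    unfolding conjugate_def by (intro SUP_upper2[of u]) auto
  then show ?thesis by auto
qed

lemma conjugate_subdifferential_nonempty:
  assumes J: "J \<in> proper_funs" and "\<rho> > 0"
    and M: "\<And>\<eta>. dist \<eta> \<phi> < \<rho> \<Longrightarrow> \<forall>(u, s)\<in>real_epigraph J. blinfun_apply \<eta> u - s \<le> M"
  shows "\<phi> \<in> dom_subdifferential (conjugate J)"
proof -
  have "subdifferential (conjugate J) \<phi> \<noteq> {}"
    using convex_epigraph_conjugate[OF J] conjugate_neq_minus_infinity[OF J] \<open>\<rho> > 0\<close>
  proof (rule subdifferential_nonempty)
    show "conjugate J \<eta> \<le> ereal M" if "dist \<eta> \<phi> < \<rho>" for \<eta>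
      using M[OF that] by (simp add: conjugate_le_iff[OF J])
  qed
  then show ?thesis by (simp add: dom_subdifferential_def)
qed

text \<open>
  The essence of the Fenchel--Moreau theorem. The set \<open>C\<close> below consists of the points above the
  inf-convolution of \<open>J\<close> with \<open>n \<parallel>\<cdot>\<parallel>\<close>. That function is convex, below \<open>J\<close> and bounded above near every
  point, so it has subgradients. For large \<open>n\<close> its value at \<open>x\<close> is still at least \<open>r\<close>: near \<open>x\<close> by lower
  semicontinuity of \<open>J\<close>, and far away because \<open>n \<parallel>\<cdot>\<parallel>\<close> outweighs the affine minorant of \<open>J\<close>.
\<close>
theorem affine_minorant_above_level:
  fixes J :: "'a::real_normed_vector \<Rightarrow> ereal"
  assumes conv: "convex (real_epigraph J)"
    and J: "J \<in> proper_funs"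
    and lsc: "\<And>r. closed {u. J u \<le> ereal r}"
    and minorant: "\<And>u. ereal (c + blinfun_apply a u) \<le> J u"
    and r: "ereal r < J x"
  obtains b :: "'a \<Rightarrow>\<^sub>L real" where "\<And>u. ereal (r + b (u - x)) \<le> J u"
proof -
  obtain x0 where "J x0 < \<infinity>" "J x0 \<noteq> - \<infinity>" using J by (auto simp: proper_funs_def eff_domain_def)
  then obtain j0 where j0: "J x0 = ereal j0" by (cases "J x0") auto
  have "open (- {u. J u \<le> ereal r})" "x \<in> - {u. J u \<le> ereal r}"
    using lsc r by (auto simp: closed_def)
  then have "\<exists>\<delta>>0. \<forall>u. dist u x < \<delta> \<longrightarrow> ereal r < J u"
    unfolding open_dist by (simp add: not_le)
  then obtain \<delta> where \<delta>: "\<delta> > 0" "\<And>u. dist u x < \<delta> \<Longrightarrow> ereal r < J u"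
    by blast
  \<comment> \<open>Beyond distance \<open>\<delta>\<close> the second summand makes up for the gap between \<open>r\<close> and the minorant
    at \<open>x\<close>; the first one cancels the slope of the minorant.\<close>
  define n where "n = norm a + \<bar>r - c - a x\<bar> / \<delta>"
  have n: "n \<ge> 0" using \<delta> by (simp add: n_def)
  have level: "r \<le> s + n * norm (x - w)" if "J w \<le> ereal s" for w s
  proof (cases "dist w x < \<delta>")
    case True
    with \<delta>(2)[of w] that have "ereal r < ereal s" by (meson less_le_trans)
    then show ?thesis using n by (simp add: add_increasing2)
  next
    case False
    then have d: "norm (x - w) \<ge> \<delta>" by (simp add: dist_norm norm_minus_commute)
    have "ereal (c + a w) \<le> ereal s" using minorant that by (rule order_trans)
    moreover have "a (x - w) \<le> norm a * norm (x - w)" using norm_blinfun[of a "x - w"] by simp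
    moreover have "\<bar>r - c - a x\<bar> / \<delta> * \<delta> \<le> \<bar>r - c - a x\<bar> / \<delta> * norm (x - w)"
      using d \<delta> by (intro mult_left_mono) auto
    ultimately show ?thesis
      using \<delta>(1) by (simp add: n_def blinfun.diff_right distrib_right)
  qed
  define C where "C = {(u, s). \<exists>w t. J w \<le> ereal t \<and> t + n * norm (u - w) \<le> s}"
  have "convex C"
    unfolding convex_def
  proof safe
    fix u1 u2 and s1 s2 \<alpha> \<beta> :: real
    assume "(u1, s1) \<in> C" "(u2, s2) \<in> C" and ab: "0 \<le> \<alpha>" "0 \<le> \<beta>" "\<alpha> + \<beta> = 1"
    then obtain w1 t1 w2 t2 where
      1: "(w1, t1) \<in> real_epigraph J" "t1 + n * norm (u1 - w1) \<le> s1" and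
      2: "(w2, t2) \<in> real_epigraph J" "t2 + n * norm (u2 - w2) \<le> s2"
      by (auto simp: C_def real_epigraph_def)
    have "\<alpha> *\<^sub>R (w1, t1) + \<beta> *\<^sub>R (w2, t2) \<in> real_epigraph J"
      using conv 1(1) 2(1) ab by (rule convexD)
    moreover have "\<alpha> * t1 + \<beta> * t2 +
      n * norm (\<alpha> *\<^sub>R u1 + \<beta> *\<^sub>R u2 - (\<alpha> *\<^sub>R w1 + \<beta> *\<^sub>R w2)) \<le> \<alpha> * s1 + \<beta> * s2"
    proof -
      have "\<alpha> *\<^sub>R u1 + \<beta> *\<^sub>R u2 - (\<alpha> *\<^sub>R w1 + \<beta> *\<^sub>R w2) = \<alpha> *\<^sub>R (u1 - w1) + \<beta> *\<^sub>R (u2 - w2)"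
        by (simp add: algebra_simps)
      moreover have "norm (\<alpha> *\<^sub>R (u1 - w1) + \<beta> *\<^sub>R (u2 - w2)) \<le> \<alpha> * norm (u1 - w1) + \<beta> * norm (u2 - w2)"
        using norm_triangle_ineq[of "\<alpha> *\<^sub>R (u1 - w1)" "\<beta> *\<^sub>R (u2 - w2)"] ab by simp
      ultimately have "n * norm (\<alpha> *\<^sub>R u1 + \<beta> *\<^sub>R u2 - (\<alpha> *\<^sub>R w1 + \<beta> *\<^sub>R w2))
          \<le> n * (\<alpha> * norm (u1 - w1) + \<beta> * norm (u2 - w2))"
        using n by (simp add: mult_left_mono)
      moreover have "\<alpha> * (t1 + n * norm (u1 - w1)) \<le> \<alpha> * s1" "\<beta> * (t2 + n * norm (u2 - w2)) \<le> \<beta> * s2"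
        using 1 2 ab by (auto intro: mult_left_mono)
      ultimately show ?thesis by (simp add: algebra_simps)
    qed
    ultimately show "\<alpha> *\<^sub>R (u1, s1) + \<beta> *\<^sub>R (u2, s2) \<in> C"
      by (auto simp: C_def real_epigraph_def)
  qed
  moreover have "r \<le> s" if "(x, s) \<in> C" for s
    using that level by (fastforce simp: C_def)
  moreover have "(u, j0 + n * (norm (x - x0) + 1)) \<in> C" if "dist u x < 1" for u
  proof -
    have "norm (u - x0) \<le> norm (x - x0) + 1"
      using that norm_triangle_ineq[of "u - x" "x - x0"] by (simp add: dist_norm)
    then have "n * norm (u - x0) \<le> n * (norm (x - x0) + 1)" using n by (rule mult_left_mono)
    then show ?thesis using j0 by (auto simp: C_def intro!: exI[of _ x0] exI[of _ j0])
  qed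
  ultimately obtain b :: "'a \<Rightarrow>\<^sub>L real" where b: "\<And>u s. (u, s) \<in> C \<Longrightarrow> r + b (u - x) \<le> s"
    by (rule subgradient_of_convex_set[OF _ _ zero_less_one]) blast+
  have "ereal (r + b (u - x)) \<le> J u" for u
  proof (rule ereal_ge_of_epigraph)
    show "J u \<noteq> - \<infinity>" using J by (simp add: proper_funs_def)
    show "r + b (u - x) \<le> s" if "J u \<le> ereal s" for s
      using that by (intro b) (auto simp: C_def intro!: exI[of _ u] exI[of _ s])
  qed
  then show ?thesis by (rule that)
qed

text \<open>
  The subdifferential of \<open>f + \<iota>\<^sub>S\<close> at \<open>x\<close> is contained in that of \<open>f\<close> plus the normal cone of \<open>S\<close>: the part \<open>b\<close> is a
  subgradient of \<open>f\<close> and \<open>\<phi> - b\<close> is normal to \<open>S\<close>. The set \<open>C\<close> lies above the value function that sends a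
  shift \<open>h\<close> to the infimum of \<open>f(s + h) - \<phi>(s)\<close> over \<open>s \<in> S\<close>. Its subgradient at \<open>h = 0\<close> is \<open>b\<close>: fixing \<open>s = x\<close>
  tests it against \<open>f\<close>, fixing \<open>s + h = x\<close> tests it against \<open>S\<close>.
\<close>
theorem subgradient_sum_rule_constraint:
  fixes f :: "'a::real_normed_vector \<Rightarrow> ereal" and \<phi> :: "'a \<Rightarrow>\<^sub>L real"
  assumes conv: "convex (real_epigraph f)" and f: "\<And>u. f u \<noteq> - \<infinity>"
    and S: "convex S" "x0 \<in> S" "x \<in> S"
    and \<rho>: "\<rho> > 0" "\<And>u. dist u x0 < \<rho> \<Longrightarrow> f u \<le> ereal M"
    and r: "f x = ereal r"
    and sub: "\<And>u. u \<in> S \<Longrightarrow> ereal (r + \<phi> (u - x)) \<le> f u"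
  obtains b :: "'a \<Rightarrow>\<^sub>L real" where "\<And>u. ereal (r + b (u - x)) \<le> f u"
    "\<And>u. u \<in> S \<Longrightarrow> \<phi> (u - x) \<le> b (u - x)"
proof -
  define L where "L = (\<lambda>((u, a), s). (u - s, a - \<phi> s))"
  define C where "C = L ` (real_epigraph f \<times> S)"
  have "linear L"
    by (rule linearI) (auto simp: L_def blinfun.add_right blinfun.scaleR_right algebra_simps)
  then have "convex C"
    unfolding C_def using conv S(1) by (intro convex_linear_image convex_Times)
  moreover have "r - \<phi> x \<le> t" if t: "(0, t) \<in> C" for t
  proof -
    obtain s a where s: "s \<in> S" "f s \<le> ereal a" "t = a - \<phi> s"
      using t by (auto simp: C_def L_def real_epigraph_def)
    have "ereal (r + \<phi> (s - x)) \<le> ereal a" using sub[OF s(1)] s(2) by (rule order_trans)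
    then show ?thesis using s(3) by (simp add: blinfun.diff_right)
  qed
  moreover have "(h, M - \<phi> x0) \<in> C" if "dist h 0 < \<rho>" for h
    using \<rho>(2)[of "x0 + h"] that S(2)
    by (auto simp: C_def L_def real_epigraph_def dist_norm intro!: image_eqI[of _ _ "((x0 + h, M), x0)"])
  ultimately obtain b :: "'a \<Rightarrow>\<^sub>L real" where b: "\<And>h t. (h, t) \<in> C \<Longrightarrow> r - \<phi> x + b (h - 0) \<le> t"
    by (rule subgradient_of_convex_set[OF _ _ \<rho>(1)]) blast+
  have b': "r - \<phi> x + b (u - s) \<le> a - \<phi> s" if "f u \<le> ereal a" "s \<in> S" for u s a
    using b[of "u - s" "a - \<phi> s"] that
    by (force simp: C_def L_def real_epigraph_def)
  show ?thesis
  proof (rule that)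
    show "ereal (r + b (u - x)) \<le> f u" for u
      using b'[of u _ x] S(3) f by (intro ereal_ge_of_epigraph) auto
    show "\<phi> (u - x) \<le> b (u - x)" if "u \<in> S" for u
      using b'[of x r u] r that by (simp add: blinfun.diff_right)
  qed
qed

section \<open>Consequences of firm subgradients\<close>

text \<open>
  Outside the ball of radius \<open>e\<close> around \<open>x\<close> the function exceeds its minimum by at least a fixed positive amount, the
  gauge \<open>\<psi>\<close> being bounded below there, so a minimizing sequence has to enter every ball.
\<close>
lemma attains_strong_minimum_of_firm_subgradient:
  fixes J :: "'a::real_normed_vector \<Rightarrow> ereal" and \<phi> :: "'a \<Rightarrow>\<^sub>L real"
  assumes J: "J \<in> proper_funs" and x: "x \<in> S" "J x = ereal r" and \<psi>: "\<psi> \<in> Gamma0"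
    and firm: "\<And>u. u \<in> S \<Longrightarrow> ereal (r + \<phi> (u - x)) + \<psi> (norm (u - x)) \<le> J u"
  shows "attains_strong_minimum (\<lambda>u. J u - ereal (\<phi> u)) S"
  unfolding attains_strong_minimum_iff
proof (intro conjI bexI[of _ x] ballI allI impI)
  have ge: "ereal (r - \<phi> x) + ereal c \<le> J u - ereal (\<phi> u)"
    if "u \<in> S" "ereal c \<le> \<psi> (norm (u - x))" for u c
  proof -
    have "ereal (r + \<phi> (u - x)) + ereal c \<le> ereal (r + \<phi> (u - x)) + \<psi> (norm (u - x))"
      using that(2) by (rule add_left_mono)
    also have "\<dots> \<le> J u" using firm that(1) by blast
    finally show ?thesis by (cases "J u") (auto simp: blinfun.diff_right)
  qed
  have nonneg: "ereal 0 \<le> \<psi> (norm (u - x))" for u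
    using \<psi> by (simp add: Gamma0_def zero_ereal_def)
  show "J x - ereal (\<phi> x) \<le> J u - ereal (\<phi> u)" if "u \<in> S" for u
    using ge[OF that nonneg] x(2) by simp
  have "J u - ereal (\<phi> u) \<noteq> - \<infinity>" for u
    using J by (cases "J u") (auto simp: proper_funs_def)
  then show "(\<lambda>u. J u - ereal (\<phi> u)) \<in> proper_funs"
    using x(2) by (auto simp: proper_funs_def eff_domain_def intro!: exI[of _ x])
  fix y assume y: "(\<forall>n. y n \<in> S) \<and> (\<lambda>n. J (y n) - ereal (\<phi> (y n))) \<longlonglongrightarrow> J x - ereal (\<phi> x)"
  show "y \<longlonglongrightarrow> x"
  proof (rule tendstoI)
    fix e :: real assume e: "e > 0"
    obtain c where c: "c > 0" "\<And>t. t \<ge> e \<Longrightarrow> ereal (c * t) \<le> \<psi> t"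
      using Gamma0_linear_growth[OF \<psi> e] by metis
    have "J x - ereal (\<phi> x) < ereal (r - \<phi> x) + ereal (c * e)"
      using c e x(2) by simp
    with y have "\<forall>\<^sub>F n in sequentially. J (y n) - ereal (\<phi> (y n)) < ereal (r - \<phi> x) + ereal (c * e)"
      using order_tendstoD(2) by blast
    then show "\<forall>\<^sub>F n in sequentially. dist (y n) x < e"
    proof eventually_elim
      case (elim n)
      show ?case
      proof (rule ccontr)
        assume "\<not> dist (y n) x < e"
        then have d: "e \<le> norm (y n - x)" by (simp add: dist_norm)
        then have "c * e \<le> c * norm (y n - x)" using c(1) by simp
        then have "ereal (c * e) \<le> \<psi> (norm (y n - x))"
          using c(2)[OF d] by (metis ereal_less_eq(3) order_trans)
        then have "ereal (r - \<phi> x) + ereal (c * e) \<le> J (y n) - ereal (\<phi> (y n))"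
          using y by (intro ge) blast+
        with elim show False by simp
      qed
    qed
  qed
qed (rule x(1))

text \<open>
  Growth at rate \<open>c\<close> outside the unit ball around \<open>x\<close> tolerates changes of \<open>\<phi>\<close> of norm less than \<open>c\<close>, so the conjugate
  is bounded on a ball of that radius and has subgradients there.
\<close>
lemma ball_in_dom_subdifferential_conjugate:
  fixes J :: "'a::real_normed_vector \<Rightarrow> ereal" and \<phi> :: "'a \<Rightarrow>\<^sub>L real"
  assumes J: "J \<in> proper_funs" and \<psi>: "\<psi> \<in> Gamma0"
    and firm: "\<And>u. ereal (r + \<phi> (u - x)) + \<psi> (norm (u - x)) \<le> J u"
  obtains c where "c > 0" "ball \<phi> c \<subseteq> dom_subdifferential (conjugate J)"
proof -
  obtain c where c: "c > 0" "\<And>t. t \<ge> 1 \<Longrightarrow> ereal (c * t) \<le> \<psi> t"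
    using Gamma0_linear_growth[OF \<psi> zero_less_one] by metis
  define M where "M = \<phi> x + c * norm x - r + c"
  have bound: "\<eta> u - s \<le> M" if \<eta>: "dist \<phi> \<eta> < c" and us: "(u, s) \<in> real_epigraph J" for \<eta> u s
  proof -
    have \<eta>c: "norm (\<eta> - \<phi>) \<le> c" using \<eta> by (simp add: dist_norm norm_minus_commute)
    have dual: "(\<eta> - \<phi>) v \<le> c * norm v" for v
    proof -
      have "(\<eta> - \<phi>) v \<le> norm (\<eta> - \<phi>) * norm v" using norm_blinfun[of "\<eta> - \<phi>" v] by simp
      also have "\<dots> \<le> c * norm v" using \<eta>c by (rule mult_right_mono) simp
      finally show ?thesis .
    qed
    have s: "ereal (r + \<phi> (u - x)) + \<psi> (norm (u - x)) \<le> ereal s"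
      using firm[of u] us by (auto simp: real_epigraph_def intro: order_trans)
    have lower: "r + \<phi> (u - x) + a \<le> s" if "ereal a \<le> \<psi> (norm (u - x))" for a
    proof -
      have "ereal (r + \<phi> (u - x)) + ereal a \<le> ereal s"
        using add_left_mono[OF that] s by (rule order_trans)
      then show ?thesis by simp
    qed
    have "(\<eta> - \<phi>) (u - x) + r + \<phi> (u - x) - c \<le> s"
    proof (cases "norm (u - x) \<ge> 1")
      case True
      then show ?thesis using lower[OF c(2)[OF True]] dual[of "u - x"] c(1) by simp
    next
      case False
      have "ereal 0 \<le> \<psi> (norm (u - x))" using \<psi> by (simp add: Gamma0_def zero_ereal_def)
      moreover have "c * norm (u - x) \<le> c * 1" using False c(1) by (intro mult_left_mono) auto
      ultimately show ?thesis using lower[of 0] dual[of "u - x"] by simp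
    qed
    then show ?thesis
      using dual[of x] by (simp add: M_def blinfun.diff_left blinfun.diff_right)
  qed
  have "ball \<phi> c \<subseteq> dom_subdifferential (conjugate J)"
  proof
    fix \<eta> assume "\<eta> \<in> ball \<phi> c"
    then obtain \<rho> where \<rho>: "\<rho> > 0" "ball \<eta> \<rho> \<subseteq> ball \<phi> c"
      by (meson open_ball open_contains_ball)
    show "\<eta> \<in> dom_subdifferential (conjugate J)"
    proof (rule conjugate_subdifferential_nonempty[OF J \<rho>(1)])
      fix \<zeta> assume "dist \<zeta> \<eta> < \<rho>"
      then have "\<zeta> \<in> ball \<eta> \<rho>" by (simp add: dist_commute)
      with \<rho>(2) have "dist \<phi> \<zeta> < c" by auto
      with bound show "\<forall>(u, s)\<in>real_epigraph J. blinfun_apply \<zeta> u - s \<le> M" by blast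
    qed
  qed
  with c(1) show ?thesis by (rule that)
qed

text \<open>
  A subgradient \<open>\<Phi>\<close> of the conjugate at \<open>\<phi>\<close> is evaluation at some \<open>x\<close>. If \<open>J(x)\<close> exceeded
  \<open>\<phi>(x) - J\<^sup>*(\<phi>)\<close>, an affine minorant of \<open>J\<close> passing above this level at \<open>x\<close> would have a slope that
  violates the subgradient inequality of \<open>\<Phi>\<close>. Hence equality holds in Young's inequality for \<open>x\<close> and \<open>\<phi>\<close>.
\<close>
lemma bidual_subgradient_is_subgradient:
  fixes J :: "'a::real_normed_vector \<Rightarrow> ereal"
  assumes refl: "reflexive_space TYPE('a)"
    and J: "J \<in> proper_funs" "convex (real_epigraph J)"
    and lsc: "\<And>r. closed {u. J u \<le> ereal r}"
    and minorant: "\<And>u. ereal (c + blinfun_apply a u) \<le> J u"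
    and \<phi>: "\<phi> \<in> dom_subdifferential (conjugate J)"
  obtains x where "\<phi> \<in> subdifferential J x"
proof -
  obtain \<Phi> where \<Phi>: "\<Phi> \<in> subdifferential (conjugate J) \<phi>"
    using \<phi> by (auto simp: dom_subdifferential_def)
  then have fin: "\<bar>conjugate J \<phi>\<bar> \<noteq> \<infinity>"
    by (auto simp: subdifferential_def split: if_splits)
  then obtain k where k: "conjugate J \<phi> = ereal k" by auto
  have sub: "ereal (k + \<Phi> (\<eta> - \<phi>)) \<le> conjugate J \<eta>" for \<eta>
    using \<Phi> k by (simp add: subdifferential_def)
  obtain x where x: "\<Phi> = bidual_embedding x"
    using refl unfolding reflexive_space_def by (metis surjD)
  have sub_x: "ereal (k + (\<eta> x - \<phi> x)) \<le> conjugate J \<eta>" for \<eta> :: "'a \<Rightarrow>\<^sub>L real"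
    using sub[of \<eta>] by (simp add: x bidual_embedding.rep_eq blinfun.diff_left)
  have Jx: "J x \<le> ereal (\<phi> x - k)"
  proof (rule ccontr)
    assume "\<not> ?thesis"
    then have "ereal (\<phi> x - k) < J x" by simp
    then obtain r where r: "ereal (\<phi> x - k) < ereal r" "ereal r < J x"
      using ereal_dense2 by blast
    obtain b :: "'a \<Rightarrow>\<^sub>L real" where b: "\<And>u. ereal (r + b (u - x)) \<le> J u"
      by (rule affine_minorant_above_level[OF J(2,1) lsc minorant r(2)]) blast
    have "b u - s \<le> b x - r" if us: "(u, s) \<in> real_epigraph J" for u s
    proof -
      have "ereal (r + b (u - x)) \<le> ereal s"
        using order_trans[OF b[of u], of "ereal s"] us by (simp add: real_epigraph_def)
      then show ?thesis by (simp add: blinfun.diff_right)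
    qed
    then have "conjugate J b \<le> ereal (b x - r)"
      by (auto simp: conjugate_le_iff[OF J(1)])
    with sub_x[of b] have "ereal (k + (b x - \<phi> x)) \<le> ereal (b x - r)" by (rule order_trans)
    with r(1) show False by simp
  qed
  have young: "\<phi> u - s \<le> k" if "J u \<le> ereal s" for u s
    using conjugate_le_iff[OF J(1), of \<phi> k] k that by (auto simp: real_epigraph_def)
  have "J x \<noteq> - \<infinity>" using J(1) by (simp add: proper_funs_def)
  then obtain r where r: "J x = ereal r" using Jx by (cases "J x") auto
  have "ereal (r + \<phi> (u - x)) \<le> J u" for u
  proof (rule ereal_ge_of_epigraph)
    show "J u \<noteq> - \<infinity>" using J(1) by (simp add: proper_funs_def)
    show "r + \<phi> (u - x) \<le> s" if "J u \<le> ereal s" for s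
      using young[OF that] Jx r by (simp add: blinfun.diff_right)
  qed
  then have "\<phi> \<in> subdifferential J x" by (simp add: subdifferential_def r)
  then show ?thesis by (rule that)
qed

text \<open>
  Adding a functional \<open>\<phi> - b\<close> that is normal to \<open>S\<close> at \<open>x\<close> only lowers the affine minorant on \<open>S\<close>, so the gauge
  \<open>\<psi>\<close> of the subgradient \<open>b\<close> of \<open>f\<close> also serves \<open>\<phi>\<close>.
\<close>
lemma firm_subgradient_of_constrained_sum:
  fixes f :: "'a::real_normed_vector \<Rightarrow> ereal" and S :: "'a set"
  assumes f: "essentially_firmly_subdifferentiable f"
    and S: "convex S" "x0 \<in> S"
    and \<rho>: "\<rho> > 0" "\<And>u. dist u x0 < \<rho> \<Longrightarrow> f u \<le> ereal M"
    and \<phi>: "\<phi> \<in> subdifferential (\<lambda>u. f u + indicator_inf S u) x"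
  obtains r \<psi> where "x \<in> S" "f x = ereal r" "\<psi> \<in> Gamma0"
    "\<And>u. ereal (r + \<phi> (u - x)) + \<psi> (norm (u - x)) \<le> f u + indicator_inf S u"
proof -
  have proper: "f \<in> proper_funs" and conv: "convex (real_epigraph f)"
    and firm: "\<And>x. x \<in> dom_subdifferential f \<Longrightarrow> firmly_subdifferentiable_at f x"
    using f unfolding essentially_firmly_subdifferentiable_def by (auto intro: convex_real_epigraph)
  have x: "x \<in> S \<inter> eff_domain f"
    and sub: "\<And>u. f x + indicator_inf S x + ereal (\<phi> (u - x)) \<le> f u + indicator_inf S u"
    using \<phi> unfolding subdifferential_def add_indicator_inf[OF proper] by (auto split: if_splits)
  have f_nm: "f u \<noteq> - \<infinity>" for u using proper by (simp add: proper_funs_def)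
  then obtain r where r: "f x = ereal r"
    using x by (cases "f x") (auto simp: eff_domain_def)
  obtain b :: "'a \<Rightarrow>\<^sub>L real" where b: "\<And>u. ereal (r + b (u - x)) \<le> f u"
    "\<And>u. u \<in> S \<Longrightarrow> \<phi> (u - x) \<le> b (u - x)"
  proof (rule subgradient_sum_rule_constraint[OF conv f_nm S _ \<rho> r, of \<phi>])
    show "ereal (r + \<phi> (u - x)) \<le> f u" if "u \<in> S" for u
      using sub[of u] that x r by (simp add: indicator_inf_def)
  qed (use x in auto)
  have b_sub: "b \<in> subdifferential f x" using b(1) r by (simp add: subdifferential_def)
  then have "x \<in> dom_subdifferential f" by (auto simp: dom_subdifferential_def)
  from firm[OF this] b_sub r obtain \<psi> where \<psi>: "\<psi> \<in> Gamma0"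
    "\<And>u. ereal (r + b (u - x)) + \<psi> (norm (u - x)) \<le> f u"
    unfolding firmly_subdifferentiable_at_def by auto
  show ?thesis
  proof (rule that[OF _ r \<psi>(1)])
    show "x \<in> S" using x by simp
    show "ereal (r + \<phi> (u - x)) + \<psi> (norm (u - x)) \<le> f u + indicator_inf S u" for u
    proof (cases "u \<in> S")
      case True
      then have "ereal (r + \<phi> (u - x)) + \<psi> (norm (u - x)) \<le> ereal (r + b (u - x)) + \<psi> (norm (u - x))"
        using b(2) by (intro add_right_mono) simp
      also have "\<dots> \<le> f u" by (rule \<psi>(2))
      finally show ?thesis using True by (simp add: indicator_inf_def)
    qed (use f_nm in \<open>simp add: indicator_inf_def\<close>)
  qed
qed

text \<open>
  The point of continuity provides both a first subgradient \<open>a\<close> of \<open>J\<close>, and with it an affine minorant, and the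
  qualification for the sum rule. Every functional in the domain of the subdifferential of the conjugate is then a firm
  subgradient of \<open>J\<close>, from which the strong minimum and openness follow; in the cofinite case that
  domain is the whole dual space.
\<close>
theorem strongly_adequate_of_essentially_firmly_subdifferentiable:
  fixes f :: "'a::banach \<Rightarrow> ereal" and S :: "'a set"
  assumes lsc: "lsc_on UNIV f"
    and S: "closed S" "convex S"
    and refl: "reflexive_space TYPE('a)"
    and f: "essentially_firmly_subdifferentiable f"
    and cont: "x0 \<in> S" "\<bar>f x0\<bar> \<noteq> \<infinity>" "isCont f x0"
  shows "strongly_adequate (\<lambda>x. f x + indicator_inf S x)"
    and "cofinite_fun (\<lambda>x. f x + indicator_inf S x) \<Longrightarrow> strongly_Tchebychev f S"
proof -
  define J where "J = (\<lambda>x. f x + indicator_inf S x)"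
  have proper: "f \<in> proper_funs" and conv: "convex (real_epigraph f)"
    using f unfolding essentially_firmly_subdifferentiable_def by (auto intro: convex_real_epigraph)
  have f_nm: "f u \<noteq> - \<infinity>" for u using proper by (simp add: proper_funs_def)
  have J_eq: "J u = (if u \<in> S then f u else \<infinity>)" for u
    using f_nm[of u] by (simp add: J_def indicator_inf_def)
  obtain r0 where r0: "f x0 = ereal r0" using cont(2) by auto
  have J_proper: "J \<in> proper_funs"
    using f_nm cont(1) r0 by (auto simp: proper_funs_def eff_domain_def J_eq intro!: exI[of _ x0])
  have "real_epigraph J = real_epigraph f \<inter> S \<times> UNIV"
    by (auto simp: real_epigraph_def J_eq split: if_splits)
  then have J_conv: "convex (real_epigraph J)"
    using conv S(2) by (auto intro: convex_Int convex_Times)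
  have J_lsc: "closed {u. J u \<le> ereal r}" for r
  proof -
    have "{u. J u \<le> ereal r} = S \<inter> {u. f u \<le> ereal r}"
      by (auto simp: J_eq split: if_splits)
    then show ?thesis using S(1) closed_sublevel_of_lsc[OF lsc] by auto
  qed
  have "(f \<longlongrightarrow> f x0) (at x0)" using cont(3) by (simp add: isCont_def)
  then have "\<forall>\<^sub>F u in at x0. f u < ereal (r0 + 1)"
    using r0 by (intro order_tendstoD) auto
  then obtain \<rho> where "\<rho> > 0" "\<And>u. u \<noteq> x0 \<Longrightarrow> dist u x0 < \<rho> \<Longrightarrow> f u < ereal (r0 + 1)"
    unfolding eventually_at by auto
  then have \<rho>: "\<rho> > 0" "\<And>u. dist u x0 < \<rho> \<Longrightarrow> f u \<le> ereal (r0 + 1)"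
    using r0 by (auto, metis ereal_less_eq(3) less_add_one less_imp_le)
  have firm: "\<exists>x r \<psi>. x \<in> S \<and> f x = ereal r \<and> \<psi> \<in> Gamma0 \<and>
      (\<forall>u. ereal (r + \<phi> (u - x)) + \<psi> (norm (u - x)) \<le> J u)"
    if "\<phi> \<in> subdifferential J x" for x and \<phi> :: "'a \<Rightarrow>\<^sub>L real"
    using firm_subgradient_of_constrained_sum[OF f S(2) cont(1) \<rho>, of \<phi> x] that
    unfolding J_def by metis
  obtain a where a: "a \<in> subdifferential f x0"
    using subdifferential_nonempty[OF conv f_nm \<rho>] by blast
  then have a_le: "ereal (r0 + a (u - x0)) \<le> f u" for u
    by (simp add: subdifferential_def r0)
  have "ereal (r0 - a x0 + a u) \<le> J u" for u
    using a_le[of u] by (simp add: J_eq blinfun.diff_right add_diff_eq diff_add_eq)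
  note to_primal = bidual_subgradient_is_subgradient[OF refl J_proper J_conv J_lsc this]
  have "a \<in> subdifferential J x0"
    using a_le cont(1) r0 by (simp add: subdifferential_def J_eq)
  have open_dom: "\<exists>c>0. ball \<phi> c \<subseteq> dom_subdifferential (conjugate J)"
    if "\<phi> \<in> subdifferential J x" for x and \<phi> :: "'a \<Rightarrow>\<^sub>L real"
    using firm[OF that] ball_in_dom_subdifferential_conjugate[OF J_proper] by metis
  have firm': "\<exists>x r \<psi>. x \<in> S \<and> f x = ereal r \<and> \<psi> \<in> Gamma0 \<and>
      (\<forall>u. ereal (r + \<phi> (u - x)) + \<psi> (norm (u - x)) \<le> J u)"
    if "\<phi> \<in> dom_subdifferential (conjugate J)" for \<phi>
    using to_primal[OF that] firm by metis
  have "strongly_adequate J"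
    unfolding strongly_adequate_def
  proof (intro conjI J_proper ballI)
    show "dom_subdifferential (conjugate J) \<noteq> {}"
      using open_dom[OF \<open>a \<in> subdifferential J x0\<close>] by auto
    show "open (dom_subdifferential (conjugate J))"
      unfolding open_contains_ball using to_primal open_dom by metis
    fix \<phi> assume "\<phi> \<in> dom_subdifferential (conjugate J)"
    from firm'[OF this] obtain x r \<psi> where x: "x \<in> S" "f x = ereal r" and \<psi>: "\<psi> \<in> Gamma0"
      "\<And>u. ereal (r + \<phi> (u - x)) + \<psi> (norm (u - x)) \<le> J u" by blast
    show "attains_strong_minimum (\<lambda>u. J u - ereal (\<phi> u)) UNIV"
    proof (rule attains_strong_minimum_of_firm_subgradient[OF J_proper UNIV_I _ \<psi>(1)])
      show "J x = ereal r" using x by (simp add: J_eq)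
    qed (rule \<psi>(2))
  qed
  then show "strongly_adequate (\<lambda>x. f x + indicator_inf S x)" by (simp add: J_def)
  assume "cofinite_fun (\<lambda>x. f x + indicator_inf S x)"
  then have cofin: "\<bar>conjugate J \<phi>\<bar> \<noteq> \<infinity>" for \<phi> by (simp add: cofinite_fun_def J_def)
  have fin: "\<exists>c. \<forall>(u, s)\<in>real_epigraph J. \<phi> u - s \<le> c" for \<phi> :: "'a \<Rightarrow>\<^sub>L real"
  proof -
    obtain k where "conjugate J \<phi> = ereal k" using cofin[of \<phi>] by auto
    then have "conjugate J \<phi> \<le> ereal k" by simp
    then show ?thesis unfolding conjugate_le_iff[OF J_proper] by blast
  qed
  show "strongly_Tchebychev f S"
    unfolding strongly_Tchebychev_def
  proof
    fix \<phi> :: "'a \<Rightarrow>\<^sub>L real"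
    have "\<phi> \<in> dom_subdifferential (conjugate J)"
      using conjugate_locally_bounded[OF fin, of \<phi>] conjugate_subdifferential_nonempty[OF J_proper]
      by blast
    from firm'[OF this] obtain x r \<psi> where x: "x \<in> S" "f x = ereal r" and \<psi>: "\<psi> \<in> Gamma0"
      "\<And>u. ereal (r + \<phi> (u - x)) + \<psi> (norm (u - x)) \<le> J u" by blast
    show "attains_strong_minimum (\<lambda>u. f u - ereal (\<phi> u)) S"
    proof (rule attains_strong_minimum_of_firm_subgradient[OF proper x \<psi>(1)])
      show "ereal (r + \<phi> (u - x)) + \<psi> (norm (u - x)) \<le> f u" if "u \<in> S" for u
        using \<psi>(2)[of u] that by (simp add: J_eq)
    qed
  qed
qed

theorem theorem2:
  fixes f :: "'a::banach \<Rightarrow> ereal" and S :: "'a set"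
  assumes "f \<in> proper_funs"
    and "lsc_on UNIV f"
    and "closed S"
    and "S \<inter> eff_domain f \<noteq> {}"
  shows "(strongly_Tchebychev f S \<longrightarrow>
           essentially_firmly_subdifferentiable (\<lambda>x. f x + indicator_inf S x) \<and>
           convex (S \<inter> eff_domain f))
       \<and> (reflexive_space TYPE('a) \<and> convex S \<and> essentially_firmly_subdifferentiable f \<and>
            (\<exists>x\<in>S. \<bar>f x\<bar> \<noteq> \<infinity> \<and> isCont f x) \<longrightarrow>
          strongly_adequate (\<lambda>x. f x + indicator_inf S x) \<and>
          (cofinite_fun (\<lambda>x. f x + indicator_inf S x) \<longrightarrow> strongly_Tchebychev f S))"
proof (intro conjI impI; (elim conjE bexE)?)
  assume "strongly_Tchebychev f S"
  with assms show "essentially_firmly_subdifferentiable (\<lambda>x. f x + indicator_inf S x)"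
    "convex (S \<inter> eff_domain f)"
    by (rule essentially_firmly_subdifferentiable_of_strongly_Tchebychev)+
next
  fix x0
  assume *: "reflexive_space TYPE('a)" "convex S" "essentially_firmly_subdifferentiable f"
    "x0 \<in> S" "\<bar>f x0\<bar> \<noteq> \<infinity>" "isCont f x0"
  note b = strongly_adequate_of_essentially_firmly_subdifferentiable[OF assms(2,3) *(2,1,3-6)]
  show "strongly_adequate (\<lambda>x. f x + indicator_inf S x)" by (rule b(1))
  show "strongly_Tchebychev f S" if "cofinite_fun (\<lambda>x. f x + indicator_inf S x)"
    using that by (rule b(2))
qed

end
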